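(* Consider the time-invariant SUTSE model, and the Kalman filter run with correlations disregarded, as described in the context, and suppose Assumptions (1), (2), (3), (4) of the context hold. Let $V_{v'}=\lim_{t\to\infty}V(v_t')$ be the limit of the covariance matrices of $v_t'$ (this limit exists under these assumptions). Fix $n_0\ge 1$ and for $n\ge n_0$ let $$\hat V_{v'}=\frac{1}{n-n_0+1}\sum_{t=n_0}^{n}v_t'v_t'^T .$$ Then $\hat V_{v'}$ is a consistent estimator of $V_{v'}$: for all $i,j\in\{1,\dots,d\}$, $\hat V_{v'}(i,j)\to V_{v'}(i,j)$ in probability as $n\to\infty$.
   Context: Model. Let $d\ge 1$, $p^{(1)},\dots,p^{(d)}\ge 1$, $p=p^{(1)}+\dots+p^{(d)}$. $Diag(\cdot)$ denotes a block-diagonal matrix, and $A(i,j)$ the $(i,j)$ entry of $A$. Let $Z=Diag(Z^{(1)},\dots,Z^{(d)})$ ($d\times p$, each $Z^{(j)}$ of size $1\times p^{(j)}$) and $T=Diag(T^{(1)},\dots,T^{(d)})$ ($p\times p$, each $T^{(j)}$ of size $p^{(j)}\times p^{(j)}$) be deterministic real matrices. The true model is, for $t=1,2,\dots$, $$y_t=Z\alpha_t+\varepsilon_t,\qquad \alpha_{t+1}=T\alpha_t+\eta_t,$$ with $\varepsilon_t\sim N(0,\Sigma_\varepsilon)$, $\eta_t\sim N(0,\Sigma_\eta)$, $\alpha_1\sim N(a_1,P_1)$, where $\alpha_1,\varepsilon_1,\varepsilon_2,\dots,\eta_1,\eta_2,\dots$ are jointly Gaussian and mutually uncorrelated (hence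 independent). Filter disregarding correlation. Let $\Sigma_\varepsilon'=Diag(\Sigma_\varepsilon(1,1),\dots,\Sigma_\varepsilon(d,d))$ and $\Sigma_\eta'=Diag(\Sigma_\eta^{(1)},\dots,\Sigma_\eta^{(d)})$, where $\Sigma_\eta^{(j)}$ is the $j$-th $p^{(j)}\times p^{(j)}$ diagonal block of $\Sigma_\eta$. Start from a deterministic vector $a_1'\in\mathbb R^p$ and a symmetric positive semidefinite block-diagonal $P_1'=Diag(P_1'^{(1)},\dots,P_1'^{(d)})$ (blocks of size $p^{(j)}\times p^{(j)}$), and define recursively $$v_t'=y_t-Za_t',\quad F_t'=ZP_t'Z^T+\Sigma_\varepsilon',\quad K_t'=P_t'Z^TF_t'^{-1},\quad L_t'=I_p-K_t'Z,\quad a_{t+1}'=Ta_t'+TK_t'v_t',\quad P_{t+1}'=TP_t'L_t'^TT^T+\Sigma_\eta'.$$ Assumptions. $\|A\|_F=\sqrt{tr(AA^T)}$ is the Frobenius norm. Products are ordered: $\prod_{i=k}^{l}TL'_{t-i}=TL'_{t-k}\,TL'_{t-k-1}\cdots TL'_{t-l}$. (1) $\Sigma_\varepsilon$ and $\Sigma_\varepsilon'$ are positive definite. (2) The matrix $(Z^T,(ZT)^T,\dots,(ZT^{p-1})^T)^T$ has rank $p$. (3) $\Sigma_\eta=RQR^T$ with $R$ of size $p\times r$ and $Q$ an $r\times r$ positive definite matrix, and $(R,TR,\dots,T^{p-1}R)$ has rank $p$; similarly $\Sigma_\eta'=R'Q'R'^T$ with $R'$ of size $p\times r'$ and $Q'$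 an $r'\times r'$ positive definite matrix, and $(R',TR',\dots,T^{p-1}R')$ has rank $p$. (4) There is $M>0$ such that for all $t\ge 1$ and all $0\le k\le l\le t-1$, $\|\prod_{i=k}^{l}TL'_{t-i}\|_F\le M$. *)

theory Defs
  imports "HOL-Analysis.Analysis" "HOL-Probability.Probability"
begin

(* The notation real^'n pins the sort of 'n to finite, which clashes with index types that are also
   linearly ordered; the synonyms leave the sort open. *)
type_synonym 'n rvec = "(real, 'n) vec"
type_synonym ('m, 'n) rmat = "((real, 'n) vec, 'm) vec"  (* m rows, n columns: real^'n^'m *)


section \<open>Matrices\<close>

(* The class operations times and power on vectors act componentwise, so matrix powers need their own
   definition. *)
primrec mat_pow :: "real^'n^'n \<Rightarrow> nat \<Rightarrow> real^'n^'n" where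
  "mat_pow A 0 = mat 1"
| "mat_pow A (Suc k) = A ** mat_pow A k"

definition frobenius_norm :: "real^'n^'m \<Rightarrow> real" where
  "frobenius_norm A = sqrt (trace (A ** transpose A))"

definition pos_semidef :: "real^'n^'n \<Rightarrow> bool" where
  "pos_semidef A \<longleftrightarrow> transpose A = A \<and> (\<forall>x. 0 \<le> x \<bullet> (A *v x))"

definition pos_def :: "real^'n^'n \<Rightarrow> bool" where
  "pos_def A \<longleftrightarrow> transpose A = A \<and> (\<forall>x. x \<noteq> 0 \<longrightarrow> 0 < x \<bullet> (A *v x))"

(* The factors are multiplied from left to right by increasing index:
   f k ** f (k + 1) ** ... ** f l *)
definition ordered_prod :: "(nat \<Rightarrow> real^'n^'n) \<Rightarrow> nat \<Rightarrow> nat \<Rightarrow> real^'n^'n" where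
  "ordered_prod f k l = foldr (\<lambda>A B. A ** B) (map f [k..<Suc l]) (mat 1)"

(* Block structure: the finite linear orders 'd and 'p stand for {1..d} and {1..p}.  A monotone
   surjection blk from 'p onto 'd cuts 'p into d consecutive nonempty intervals, the j-th of which
   has p^(j) = card (blk -` {j}) elements. *)

definition block_diagonal :: "('p \<Rightarrow> 'd) \<Rightarrow> real^'p^'p \<Rightarrow> bool" where
  "block_diagonal blk A \<longleftrightarrow> (\<forall>i j. blk i \<noteq> blk j \<longrightarrow> A $ i $ j = 0)"

definition row_block_diagonal :: "('p \<Rightarrow> 'd) \<Rightarrow> real^'p^'d \<Rightarrow> bool" where
  "row_block_diagonal blk A \<longleftrightarrow> (\<forall>i j. blk j \<noteq> i \<longrightarrow> A $ i $ j = 0)"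

definition block_diag_part :: "('p \<Rightarrow> 'd) \<Rightarrow> real^'p^'p \<Rightarrow> real^'p^'p" where
  "block_diag_part blk A = (\<chi> i j. if blk i = blk j then A $ i $ j else 0)"

definition diag_part :: "real^'d^'d \<Rightarrow> real^'d^'d" where
  "diag_part A = (\<chi> i j. if i = j then A $ i $ j else 0)"

(* Position of an index in its finite linear order, running through 0, ..., CARD('p) - 1. *)
definition pos_of :: "'p::{finite,linorder} \<Rightarrow> nat" where
  "pos_of k = card {i. i < k}"

(* The stacked matrix with block rows Z, Z T, ..., Z T^(p-1). *)
definition observability_matrix ::
    "('d::finite, 'p::{finite,linorder}) rmat \<Rightarrow> ('p, 'p) rmat \<Rightarrow> ('p \<times> 'd, 'p) rmat" where
  "observability_matrix Z T = (\<chi> r. (Z ** mat_pow T (pos_of (fst r))) $ snd r)"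

(* The matrix with block columns R, T R, ..., T^(p-1) R. *)
definition controllability_matrix ::
    "('p::{finite,linorder}, 'p) rmat \<Rightarrow> ('p, 'r::finite) rmat \<Rightarrow> ('p, 'p \<times> 'r) rmat" where
  "controllability_matrix T R = (\<chi> i c. (mat_pow T (pos_of (fst c)) ** R) $ i $ snd c)"

definition outer_prod :: "real^'m \<Rightarrow> real^'n \<Rightarrow> real^'n^'m" where
  "outer_prod x y = (\<chi> i j. x $ i * y $ j)"


section \<open>Random vectors\<close>

definition (in prob_space) cross_cov ::
    "('a \<Rightarrow> real^'m) \<Rightarrow> ('a \<Rightarrow> real^'n) \<Rightarrow> real^'n^'m" where
  "cross_cov X Y = (\<chi> i j. expectation (\<lambda>\<omega>.
      (X \<omega> $ i - expectation (\<lambda>\<omega>. X \<omega> $ i)) * (Y \<omega> $ j - expectation (\<lambda>\<omega>. Y \<omega> $ j))))"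

definition (in prob_space) cov_matrix :: "('a \<Rightarrow> real^'n) \<Rightarrow> real^'n^'n" where
  "cov_matrix X = cross_cov X X"

definition (in prob_space) uncorrelated ::
    "('a \<Rightarrow> real^'m) \<Rightarrow> ('a \<Rightarrow> real^'n) \<Rightarrow> bool" where
  "uncorrelated X Y \<longleftrightarrow> cross_cov X Y = 0"

(* X has law N(m, s), s being the variance; s = 0 gives the point mass at m. *)
definition (in prob_space) normal_rv :: "('a \<Rightarrow> real) \<Rightarrow> real \<Rightarrow> real \<Rightarrow> bool" where
  "normal_rv X m s \<longleftrightarrow> random_variable borel X \<and>
     (s = 0 \<and> (AE \<omega> in M. X \<omega> = m) \<or> 0 < s \<and> distributed M lborel X (normal_density m (sqrt s)))"

(* X has law N(mu, Sigma) with a possibly singular covariance matrix Sigma: every linear functional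
   of X is normal with the corresponding mean and variance (Cramer-Wold).  Symmetry is required
   because the quadratic form only sees the symmetric part of Sigma. *)
definition (in prob_space) normal_vec :: "('a \<Rightarrow> real^'n) \<Rightarrow> real^'n \<Rightarrow> real^'n^'n \<Rightarrow> bool" where
  "normal_vec X \<mu> \<Sigma> \<longleftrightarrow> random_variable borel X \<and> transpose \<Sigma> = \<Sigma> \<and>
     (\<forall>u. normal_rv (\<lambda>\<omega>. u \<bullet> X \<omega>) (u \<bullet> \<mu>) (u \<bullet> (\<Sigma> *v u)))"

(* A set of real random variables is jointly Gaussian if every finite linear combination of its
   members is (possibly degenerate) normal. *)
definition (in prob_space) jointly_gaussian :: "('a \<Rightarrow> real) set \<Rightarrow> bool" where
  "jointly_gaussian S \<longleftrightarrow> (\<forall>F c. finite F \<and> F \<subseteq> S \<longrightarrow>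
     (\<exists>m s. normal_rv (\<lambda>\<omega>. \<Sum>X\<in>F. c X * X \<omega>) m s))"

definition coord_rvs :: "('a \<Rightarrow> real^'n) \<Rightarrow> ('a \<Rightarrow> real) set" where
  "coord_rvs X = range (\<lambda>i. \<lambda>\<omega>. X \<omega> $ i)"

definition (in prob_space) converges_in_prob :: "(nat \<Rightarrow> 'a \<Rightarrow> real) \<Rightarrow> real \<Rightarrow> bool" where
  "converges_in_prob X c \<longleftrightarrow> (\<forall>n. random_variable borel (X n)) \<and>
     (\<forall>e>0. (\<lambda>n. prob {\<omega> \<in> space M. \<bar>X n \<omega> - c\<bar> > e}) \<longlonglongrightarrow> 0)"

end

theory Submission
  imports Defs
begin

text \<open>Let \<open>A\<^sub>t = TL'\<^sub>t\<close>. Everything rests on the exponential decay of the products \<open>A\<^sub>t\<dots>A\<^sub>s\<close>. By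
  observability a dead-beat control bounds the quadratic forms \<open>q\<^sub>t x = x \<bullet> (P'\<^sub>t *v x)\<close> uniformly
  in \<open>t\<close>; by controllability \<open>p\<close> steps of the recursion add at least \<open>c |x|\<^sup>2\<close> to them. Hence \<open>p\<close>
  factors, transposed, contract \<open>q\<close> by a fixed ratio. As two Riccati iterates satisfy
  \<open>ric P - ric Q = A(P) (P - Q) A(Q)\<^sup>T\<close>, the sequence \<open>P'\<^sub>t\<close> is then Cauchy.

  The prediction error \<open>e\<^sub>t = \<alpha>\<^sub>t - a'\<^sub>t\<close> obeys \<open>e\<^sub>t\<^sub>+\<^sub>1 = A\<^sub>t e\<^sub>t + \<eta>\<^sub>t - TK'\<^sub>t \<epsilon>\<^sub>t\<close>, so its mean tends
  to zero, its covariance converges, and the autocovariances of \<open>v'\<^sub>t = Z e\<^sub>t + \<epsilon>\<^sub>t\<close> decay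
  exponentially. Finally \<open>cov(x\<^sup>2, y\<^sup>2) = 2 cov(x, y)\<^sup>2\<close> for centred jointly Gaussian variables, so the
  averages of squares of linear functionals of \<open>v'\<^sub>t\<close> converge in \<open>L\<^sup>1\<close>, and the
  products follow by polarization.\<close>

subsection \<open>Matrix norms and quadratic forms\<close>

text \<open>The obstacle is that the filter works with the wrong noise covariances. So
  \<open>P' t\<close> is not the covariance of the prediction error, and \<open>v'\<close> need not
  be white noise: its autocovariances are not zero in general, they only decay. Hence
  \<open>P' t\<close> is treated as a purely deterministic Riccati sequence, and the true error
  covariance as a second, linear recursion whose coefficients vary with time. Transposes appear
  because the Riccati map is the value of a control problem for the dual dynamics given by
  \<open>transpose T\<close> and \<open>transpose Z\<close>. Under the optimal control the dual
  state moves by the transposed closed loop, and what the energy loses is the running cost. Over p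
  steps this cost is at least c |x|^2, while the energy at the start is at most B |x|^2; this is
  where the ratio 1 - c/B comes from.\<close>

lemma inner_matrix_vector_transpose:
  fixes A :: "real^'n^'m"
  shows "x \<bullet> (A *v y) = (transpose A *v x) \<bullet> y"
  by (simp add: dot_lmul_matrix)

text \<open>As a simp rule it would turn \<open>transpose A *v x\<close> into \<open>x v* A\<close>;
  the dual dynamics are written with \<open>transpose\<close> throughout.\<close>

declare transpose_matrix_vector [simp del]

text \<open>On \<open>real^'n^'m\<close> the \<open>norm\<close> is the Euclidean norm of the row
  norms, that is, the Frobenius norm; the bound is Cauchy-Schwarz row by row.\<close>

lemma norm_matrix_vector_le:
  fixes A :: "real^'n^'m"
  shows "norm (A *v x) \<le> norm A * norm x"
proof -
  have "norm (A *v x) = L2_set (\<lambda>k. \<bar>(A $ k) \<bullet> x\<bar>) UNIV"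
    by (simp add: norm_vec_def matrix_vector_mul_component)
  also have "\<dots> \<le> L2_set (\<lambda>k. norm (A $ k) * norm x) UNIV"
    by (intro L2_set_mono Cauchy_Schwarz_ineq2) auto
  also have "\<dots> = norm A * norm x"
    by (simp add: norm_vec_def L2_set_left_distrib)
  finally show ?thesis .
qed

lemma norm_transpose:
  fixes A :: "real^'n^'m"
  shows "norm (transpose A) = norm A"
proof -
  have *: "norm B = sqrt (\<Sum>i\<in>UNIV. \<Sum>j\<in>UNIV. (B $ i $ j)\<^sup>2)" for B :: "real^'a^'b"
    by (simp add: norm_vec_def L2_set_def sum_nonneg)
  show ?thesis
    unfolding * by (subst sum.swap) (simp add: transpose_def)
qed

lemma norm_matrix_mult_le:
  fixes A :: "real^'n^'m" and B :: "real^'k^'n"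
  shows "norm (A ** B) \<le> norm A * norm B"
proof -
  have row: "(A ** B) $ i = transpose B *v (A $ i)" for i
    by (simp add: vec_eq_iff matrix_matrix_mult_def matrix_vector_mult_def transpose_def
        mult.commute)
  have "norm (A ** B) = L2_set (\<lambda>i. norm (transpose B *v (A $ i))) UNIV"
    by (simp add: norm_vec_def[of "A ** B"] row)
  also have "\<dots> \<le> L2_set (\<lambda>i. norm (A $ i) * norm B) UNIV"
  proof (rule L2_set_mono)
    show "norm (transpose B *v (A $ i)) \<le> norm (A $ i) * norm B" for i
      using norm_matrix_vector_le[of "transpose B" "A $ i"] unfolding norm_transpose
      by (simp only: mult.commute)
  qed simp
  also have "\<dots> = norm A * norm B"
    by (simp add: norm_vec_def[of A] L2_set_left_distrib)
  finally show ?thesis .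
qed

lemma norm_matrix_mult3_le:
  fixes A :: "real^'n^'m" and B :: "real^'k^'n" and C :: "real^'l^'k"
  shows "norm (A ** B ** C) \<le> norm A * norm B * norm C"
  by (intro order_trans[OF norm_matrix_mult_le] mult_right_mono norm_matrix_mult_le norm_ge_zero)

text \<open>Makes the general rules on limits, sums and differences available for matrix
  products.\<close>

lemma bounded_bilinear_matrix_mult:
  "bounded_bilinear ((**) :: real^'n^'m \<Rightarrow> real^'k^'n \<Rightarrow> real^'k^'m)"
proof
  show "\<exists>K. \<forall>a b. norm ((a::real^'n^'m) ** (b::real^'k^'n)) \<le> norm a * norm b * K"
    using norm_matrix_mult_le by (intro exI[of _ 1]) auto
next
  fix a a' :: "real^'n^'m" and b b' :: "real^'k^'n" and r :: real
  show "(a + a') ** b = a ** b + a' ** b"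
    by (simp add: vec_eq_iff matrix_matrix_mult_def distrib_right sum.distrib)
  show "a ** (b + b') = a ** b + a ** b'"
    by (rule matrix_add_ldistrib)
  show "(r *\<^sub>R a) ** b = r *\<^sub>R (a ** b)"
    by (simp add: vec_eq_iff matrix_matrix_mult_def sum_distrib_left mult.assoc)
  show "a ** (r *\<^sub>R b) = r *\<^sub>R (a ** b)"
    by (simp add: vec_eq_iff matrix_matrix_mult_def sum_distrib_left mult.left_commute)
qed

lemmas tendsto_matrix_mult [tendsto_intros] = bounded_bilinear.tendsto[OF bounded_bilinear_matrix_mult]
lemmas matrix_mult_zero_left [simp] = bounded_bilinear.zero_left[OF bounded_bilinear_matrix_mult]
lemmas matrix_mult_zero_right [simp] = bounded_bilinear.zero_right[OF bounded_bilinear_matrix_mult]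
lemmas matrix_mult_diff_left = bounded_bilinear.diff_left[OF bounded_bilinear_matrix_mult]
lemmas matrix_mult_diff_right = bounded_bilinear.diff_right[OF bounded_bilinear_matrix_mult]
lemmas matrix_mult_add_left = bounded_bilinear.add_left[OF bounded_bilinear_matrix_mult]
lemmas matrix_mult_add_right = bounded_bilinear.add_right[OF bounded_bilinear_matrix_mult]

lemma transpose_add: "transpose (A + B) = transpose A + transpose (B :: real^'n^'m)"
  by (simp add: vec_eq_iff transpose_def)

lemma transpose_diff: "transpose (A - B) = transpose A - transpose (B :: real^'n^'m)"
  by (simp add: vec_eq_iff transpose_def)

lemma bounded_bilinear_matrix_vector_mult:
  "bounded_bilinear ((*v) :: real^'n^'m \<Rightarrow> real^'n \<Rightarrow> real^'m)"
proof
  show "\<exists>K. \<forall>a b. norm ((a::real^'n^'m) *v b) \<le> norm a * norm b * K"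
    using norm_matrix_vector_le by (intro exI[of _ 1]) auto
next
  fix a a' :: "real^'n^'m" and b b' :: "real^'n" and r :: real
  show "(r *\<^sub>R a) *v b = r *\<^sub>R (a *v b)"
    by (simp add: vec_eq_iff matrix_vector_mult_def sum_distrib_left mult.assoc)
qed (simp_all add: matrix_vector_mult_add_rdistrib matrix_vector_right_distrib
    matrix_vector_mult_scaleR)

lemmas tendsto_matrix_vector_mult [tendsto_intros] =
  bounded_bilinear.tendsto[OF bounded_bilinear_matrix_vector_mult]

lemma mat_pow_Suc_right: "mat_pow A (Suc k) = mat_pow A k ** A"
  by (induction k) (simp, metis mat_pow.simps(2) matrix_mul_assoc)

lemma tendsto_transpose [tendsto_intros]:
  fixes f :: "'a \<Rightarrow> real^'n^'m"
  assumes "(f \<longlongrightarrow> A) F"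
  shows "((\<lambda>x. transpose (f x)) \<longlongrightarrow> transpose A) F"
  unfolding transpose_def using assms by (intro tendsto_vec_lambda tendsto_vec_nth)

lemma tendsto_matrixI:
  fixes f :: "'a \<Rightarrow> real^'n^'m"
  assumes "\<And>i j. ((\<lambda>x. f x $ i $ j) \<longlongrightarrow> A $ i $ j) F"
  shows "(f \<longlongrightarrow> A) F"
  using assms by (intro vec_tendstoI)

lemma norm_matrix_le_entries:
  fixes A :: "real^'n^'m"
  assumes "\<And>i j. \<bar>A $ i $ j\<bar> \<le> B"
  shows "norm A \<le> real CARD('m) * (real CARD('n) * B)"
proof -
  have "norm A \<le> (\<Sum>i\<in>UNIV. norm (A $ i))"
    unfolding norm_vec_def by (intro L2_set_le_sum) auto
  also have "\<dots> \<le> (\<Sum>i\<in>(UNIV::'m set). \<Sum>j\<in>(UNIV::'n set). B)"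
    by (intro sum_mono order_trans[OF norm_le_l1_cart] assms)
  finally show ?thesis by simp
qed

text \<open>Testing on basis vectors bounds every entry. The dimension factors are harmless, since
  bounds are needed only up to a constant.\<close>

lemma norm_matrix_le_of_bound:
  fixes A :: "real^'n^'m"
  assumes "\<And>x. norm (A *v x) \<le> b * norm x"
  shows "norm A \<le> real CARD('m) * (real CARD('n) * b)"
proof (rule norm_matrix_le_entries)
  fix i j
  have "\<bar>A $ i $ j\<bar> \<le> norm (A *v axis j 1)"
    using component_le_norm_cart[of "A *v axis j 1" i] by (simp add: matrix_vector_mult_basis column_def)
  also have "\<dots> \<le> b" using assms[of "axis j 1"] by simp
  finally show "\<bar>A $ i $ j\<bar> \<le> b" .
qed

lemma entry_eq_inner: "A $ i $ j = axis i 1 \<bullet> ((A::real^'n^'m) *v axis j 1)"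
  by (simp add: inner_axis' matrix_vector_mult_basis column_def)

lemma abs_entry_le_norm: "\<bar>(A::real^'n^'m) $ i $ j\<bar> \<le> norm A"
  using component_le_norm_cart[of "A $ i" j] Finite_Cartesian_Product.norm_nth_le[of A i] by auto

section \<open>Positive semidefinite and positive definite matrices\<close>

lemma pos_semidef_0: "pos_semidef 0"
  by (simp add: pos_semidef_def transpose_def vec_eq_iff)

lemma pos_def_imp_pos_semidef: "pos_def A \<Longrightarrow> pos_semidef A"
  unfolding pos_def_def pos_semidef_def by (metis inner_zero_left less_eq_real_def)

lemma pos_semidef_quad_nonneg: "pos_semidef A \<Longrightarrow> 0 \<le> x \<bullet> (A *v x)"
  by (simp add: pos_semidef_def)

lemma sym_quad_commute:
  fixes A :: "real^'n^'n"
  assumes "transpose A = A"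
  shows "x \<bullet> (A *v y) = y \<bullet> (A *v x)"
  by (metis assms inner_commute inner_matrix_vector_transpose)

lemma pos_semidef_tendsto:
  fixes A :: "nat \<Rightarrow> real^'n^'n"
  assumes "A \<longlonglongrightarrow> L" "\<And>n. pos_semidef (A n)"
  shows "pos_semidef L"
  unfolding pos_semidef_def
proof (intro conjI allI)
  have "(\<lambda>n. transpose (A n)) \<longlonglongrightarrow> transpose L" by (intro tendsto_intros assms)
  moreover have "transpose (A n) = A n" for n using assms(2) by (simp add: pos_semidef_def)
  ultimately show "transpose L = L" using assms(1) LIMSEQ_unique by simp
  fix x
  have "(\<lambda>n. x \<bullet> (A n *v x)) \<longlonglongrightarrow> x \<bullet> (L *v x)" by (intro tendsto_intros assms)
  then show "0 \<le> x \<bullet> (L *v x)"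
    using assms(2) by (intro LIMSEQ_le_const) (auto simp: pos_semidef_quad_nonneg)
qed

text \<open>The constant is the minimum of the form on the unit sphere, attained by compactness and
  hence positive; homogeneity does the rest.\<close>

lemma pos_def_coercive:
  fixes A :: "real^'n^'n"
  assumes "pos_def A"
  obtains c where "c > 0" "\<And>x. c * (norm x)\<^sup>2 \<le> x \<bullet> (A *v x)"
proof -
  have 1: "compact (sphere (0::real^'n) 1)" and 2: "sphere (0::real^'n) 1 \<noteq> {}"
    by auto
  have 3: "continuous_on (sphere (0::real^'n) 1) (\<lambda>x. x \<bullet> (A *v x))"
    by (intro continuous_intros linear_continuous_on matrix_vector_mul_bounded_linear)
  obtain x0 where x0: "x0 \<in> sphere 0 1"
    "\<And>y. y \<in> sphere 0 1 \<Longrightarrow> x0 \<bullet> (A *v x0) \<le> y \<bullet> (A *v y)"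
    using continuous_attains_inf[OF 1 2 3] by blast
  have "x0 \<bullet> (A *v x0) * (norm x)\<^sup>2 \<le> x \<bullet> (A *v x)" for x
  proof (cases "x = 0")
    case False
    define z where "z = (1 / norm x) *\<^sub>R x"
    have "z \<in> sphere 0 1" "x = norm x *\<^sub>R z" using False by (auto simp: z_def)
    then have "x \<bullet> (A *v x) = (norm x)\<^sup>2 * (z \<bullet> (A *v z))"
      by (metis (no_types, lifting) inner_scaleR_left inner_scaleR_right matrix_vector_mult_scaleR
          mult.assoc power2_eq_square)
    with x0(2)[OF \<open>z \<in> sphere 0 1\<close>] show ?thesis
      by (simp add: mult.commute mult_right_mono)
  qed simp
  moreover have "x0 \<noteq> 0" using x0(1) by auto
  then have "x0 \<bullet> (A *v x0) > 0" using assms x0(1) by (auto simp: pos_def_def)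
  ultimately show thesis using that by blast
qed

lemma quad_le_norm: "x \<bullet> ((A::real^'n^'n) *v x) \<le> norm A * (norm x)\<^sup>2"
proof -
  have "x \<bullet> (A *v x) \<le> norm x * (norm A * norm x)"
    by (intro order_trans[OF norm_cauchy_schwarz] mult_left_mono norm_matrix_vector_le) auto
  then show ?thesis by (simp add: power2_eq_square ac_simps)
qed

text \<open>Nonnegativity at the sum and at the difference of two basis vectors bounds twice an
  off-diagonal entry by the sum of two diagonal ones. So finitely many values of the form control
  the whole matrix.\<close>

lemma pos_semidef_entry_le:
  fixes A :: "real^'n^'n"
  assumes "pos_semidef A" "\<And>i. axis i 1 \<bullet> (A *v axis i 1) \<le> B"
  shows "\<bar>A $ i $ j\<bar> \<le> B"
proof -
  let ?a = "axis i 1 :: real^'n" and ?b = "axis j 1 :: real^'n"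
  have "0 \<le> (?a + ?b) \<bullet> (A *v (?a + ?b))" "0 \<le> (?a - ?b) \<bullet> (A *v (?a - ?b))"
    using assms(1) pos_semidef_quad_nonneg by blast+
  moreover have "?b \<bullet> (A *v ?a) = ?a \<bullet> (A *v ?b)"
    using assms(1) by (simp add: pos_semidef_def sym_quad_commute)
  ultimately show ?thesis
    using assms(2)[of i] assms(2)[of j]
    by (simp add: entry_eq_inner[of A i j] inner_add inner_diff matrix_vector_right_distrib
        matrix_vector_mult_diff_distrib algebra_simps)
qed

lemma pos_def_invertible:
  fixes A :: "real^'n^'n"
  assumes "pos_def A"
  shows "invertible A"
proof -
  have "\<forall>x. A *v x = 0 \<longrightarrow> x = 0"
    using assms unfolding pos_def_def by (metis inner_zero_right less_irrefl)
  then show ?thesis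
    using matrix_left_invertible_ker invertible_left_inverse by blast
qed

text \<open>Polarization. It serves to identify covariance matrices, because
  \<open>normal_vec\<close> describes them only through the variances of linear functionals.\<close>

lemma matrix_eq_of_quad_eq:
  fixes A B :: "real^'n^'n"
  assumes "transpose A = A" "transpose B = B" "\<And>x. x \<bullet> (A *v x) = x \<bullet> (B *v x)"
  shows "A = B"
proof -
  have "A $ i $ j = B $ i $ j" for i j
  proof -
    let ?a = "axis i 1 :: real^'n" and ?b = "axis j 1 :: real^'n"
    have *: "2 * (?a \<bullet> (C *v ?b)) = (?a + ?b) \<bullet> (C *v (?a + ?b)) - ?a \<bullet> (C *v ?a) - ?b \<bullet> (C *v ?b)"
      if "transpose C = C" for C :: "real^'n^'n"
      using sym_quad_commute[OF that, of ?a ?b]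
      by (simp add: inner_add matrix_vector_right_distrib)
    show ?thesis
      using *[OF assms(1)] *[OF assms(2)] assms(3) by (simp add: entry_eq_inner)
  qed
  then show ?thesis by (simp add: vec_eq_iff)
qed

subsection \<open>The Riccati recursion\<close>

text \<open>\<open>S\<close> and \<open>W\<close> are the noise covariances that the filter believes
  in, finally \<open>\<Sigma>\<epsilon>'\<close> and \<open>\<Sigma>\<eta>'\<close>. The true ones
  enter only in \<open>prediction_error\<close>.\<close>

locale riccati =
  fixes Z :: "real^'p^'d" and T :: "real^'p^'p" and S :: "real^'d^'d" and W :: "real^'p^'p"
  assumes S_pos_def: "pos_def S" and W_pos_semidef: "pos_semidef W"
begin

definition innov_cov :: "real^'p^'p \<Rightarrow> real^'d^'d" where
  "innov_cov P = Z ** P ** transpose Z + S"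

definition gain :: "real^'p^'p \<Rightarrow> real^'d^'p" where
  "gain P = P ** transpose Z ** matrix_inv (innov_cov P)"

definition filt :: "real^'p^'p \<Rightarrow> real^'p^'p" where
  "filt P = mat 1 - gain P ** Z"

definition closed_loop :: "real^'p^'p \<Rightarrow> real^'p^'p" where
  "closed_loop P = T ** filt P"

definition ric :: "real^'p^'p \<Rightarrow> real^'p^'p" where
  "ric P = T ** P ** transpose (filt P) ** transpose T + W"

text \<open>The Riccati map is the value of a one-step linear-quadratic control problem for the dual
  dynamics: \<open>x \<bullet> ric P x\<close> is the minimum of \<open>step_cost P x u\<close> over all controls \<open>u\<close>.\<close>

definition step_cost :: "real^'p^'p \<Rightarrow> real^'p \<Rightarrow> real^'d \<Rightarrow> real" where
  "step_cost P x u = x \<bullet> (W *v x) + u \<bullet> (S *v u) +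
     (transpose T *v x - transpose Z *v u) \<bullet> (P *v (transpose T *v x - transpose Z *v u))"

definition opt_ctrl :: "real^'p^'p \<Rightarrow> real^'p \<Rightarrow> real^'d" where
  "opt_ctrl P x = transpose (gain P) *v (transpose T *v x)"

section \<open>Algebra of the gain and of the filter matrix\<close>

lemma S_sym: "transpose S = S"
  using S_pos_def by (simp add: pos_def_def)

lemma W_sym: "transpose W = W"
  using W_pos_semidef by (simp add: pos_semidef_def)

lemma innov_cov_sym: "transpose P = P \<Longrightarrow> transpose (innov_cov P) = innov_cov P"
  by (simp add: innov_cov_def transpose_add matrix_transpose_mul S_sym matrix_mul_assoc)

lemma innov_cov_vec: "innov_cov P *v u = Z *v (P *v (transpose Z *v u)) + S *v u"
  by (simp add: innov_cov_def matrix_vector_mult_add_rdistrib matrix_vector_mul_assoc matrix_mul_assoc)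

lemma innov_cov_quad:
  "u \<bullet> (innov_cov P *v u) = (transpose Z *v u) \<bullet> (P *v (transpose Z *v u)) + u \<bullet> (S *v u)"
  unfolding innov_cov_vec inner_add_right by (simp add: inner_matrix_vector_transpose[of u Z])

lemma innov_cov_pos_def:
  assumes "pos_semidef P"
  shows "pos_def (innov_cov P)"
  unfolding pos_def_def
proof (intro conjI allI impI)
  show "transpose (innov_cov P) = innov_cov P"
    using assms innov_cov_sym by (simp add: pos_semidef_def)
  fix u :: "real^'d" assume "u \<noteq> 0"
  then have "u \<bullet> (S *v u) > 0" using S_pos_def by (simp add: pos_def_def)
  moreover have "(transpose Z *v u) \<bullet> (P *v (transpose Z *v u)) \<ge> 0"
    using assms by (rule pos_semidef_quad_nonneg)
  ultimately show "0 < u \<bullet> (innov_cov P *v u)" unfolding innov_cov_quad by linarith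
qed

lemma matrix_inv_innov_cov:
  assumes "pos_semidef P"
  shows "innov_cov P ** matrix_inv (innov_cov P) = mat 1"
    and "matrix_inv (innov_cov P) ** innov_cov P = mat 1"
  using pos_def_invertible[OF innov_cov_pos_def[OF assms]]
  unfolding invertible_def matrix_inv_def by (rule someI2_ex, blast)+

lemma matrix_inv_innov_cov_sym:
  assumes "pos_semidef P"
  shows "transpose (matrix_inv (innov_cov P)) = matrix_inv (innov_cov P)"
proof -
  let ?F = "innov_cov P"
  have "transpose (matrix_inv ?F) ** ?F = transpose (?F ** matrix_inv ?F)"
    using assms innov_cov_sym[of P] by (simp add: matrix_transpose_mul pos_semidef_def)
  then have 1: "transpose (matrix_inv ?F) ** ?F = mat 1"
    by (simp add: matrix_inv_innov_cov(1)[OF assms])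
  have "transpose (matrix_inv ?F) = transpose (matrix_inv ?F) ** (?F ** matrix_inv ?F)"
    by (simp add: matrix_inv_innov_cov(1)[OF assms])
  also have "\<dots> = matrix_inv ?F" by (simp add: matrix_mul_assoc 1)
  finally show ?thesis .
qed

lemma gain_innov_cov:
  assumes "pos_semidef P"
  shows "gain P ** innov_cov P = P ** transpose Z"
  using matrix_inv_innov_cov(2)[OF assms] by (simp add: gain_def flip: matrix_mul_assoc)

lemma innov_cov_transpose_gain:
  assumes "pos_semidef P"
  shows "innov_cov P ** transpose (gain P) = Z ** P"
proof -
  have "transpose P = P" using assms by (simp add: pos_semidef_def)
  then show ?thesis
    using arg_cong[OF gain_innov_cov[OF assms], of transpose] innov_cov_sym[of P]
    by (simp add: matrix_transpose_mul)
qed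

text \<open>Write \<open>Z ** P ** transpose Z\<close> as \<open>innov_cov P - S\<close> and use
  \<open>gain_innov_cov\<close>. The cancellations in \<open>obs_opt_residual\<close>,
  \<open>ric_diff\<close> and \<open>gain_diff\<close> come from this identity.\<close>

lemma filt_mult_transpose:
  assumes "pos_semidef P"
  shows "filt P ** P ** transpose Z = gain P ** S"
proof -
  have "filt P ** P ** transpose Z = P ** transpose Z - gain P ** (innov_cov P - S)"
    by (simp add: filt_def innov_cov_def matrix_mult_diff_left matrix_mul_assoc)
  also have "\<dots> = gain P ** S"
    by (simp add: matrix_mult_diff_right gain_innov_cov[OF assms])
  finally show ?thesis .
qed

text \<open>Both sides expand to
  \<open>P - P ** transpose Z ** matrix_inv (innov_cov P) ** Z ** P\<close>.\<close>

lemma filt_sym: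
  assumes "pos_semidef P"
  shows "P ** transpose (filt P) = filt P ** P"
proof -
  have "transpose P = P" using assms by (simp add: pos_semidef_def)
  then show ?thesis
    by (simp add: filt_def gain_def transpose_diff matrix_transpose_mul matrix_mult_diff_left
        matrix_mult_diff_right matrix_inv_innov_cov_sym[OF assms] matrix_mul_assoc)
qed

lemma transpose_filt_vec:
  "transpose (filt P) *v b = b - transpose Z *v (transpose (gain P) *v b)"
  by (simp add: filt_def transpose_diff matrix_transpose_mul matrix_vector_mult_diff_rdistrib
      matrix_vector_mul_assoc)

lemma transpose_closed_loop_vec:
  "transpose (closed_loop P) *v x = transpose T *v x - transpose Z *v opt_ctrl P x"
  by (simp add: closed_loop_def opt_ctrl_def matrix_transpose_mul transpose_filt_vec
      flip: matrix_vector_mul_assoc)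

text \<open>The first-order condition of the control problem: the derivative of the cost in the
  control vanishes at \<open>transpose (gain P) *v b\<close>.\<close>

lemma obs_opt_residual:
  assumes "pos_semidef P"
  shows "Z *v (P *v (b - transpose Z *v (transpose (gain P) *v b))) = S *v (transpose (gain P) *v b)"
proof -
  have "transpose P = P" using assms by (simp add: pos_semidef_def)
  then have "Z ** P ** transpose (filt P) = S ** transpose (gain P)"
    using arg_cong[OF filt_mult_transpose[OF assms], of transpose]
    by (simp add: matrix_transpose_mul S_sym matrix_mul_assoc)
  then have "Z ** P ** transpose (filt P) *v b = S ** transpose (gain P) *v b"
    by simp
  then show ?thesis
    by (simp add: transpose_filt_vec[symmetric] flip: matrix_vector_mul_assoc)
qed

text \<open>Split \<open>b\<close> into the residual and \<open>transpose Z *v u b\<close>; by the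
  first-order condition the second part contributes exactly the control cost.\<close>

lemma filt_quad:
  assumes "pos_semidef P"
  defines "u \<equiv> \<lambda>b. transpose (gain P) *v b"
  shows "b \<bullet> (P *v (transpose (filt P) *v b)) =
    u b \<bullet> (S *v u b) + (b - transpose Z *v u b) \<bullet> (P *v (b - transpose Z *v u b))"
proof -
  have "(transpose Z *v u b) \<bullet> (P *v (b - transpose Z *v u b)) = u b \<bullet> (S *v u b)"
    using obs_opt_residual[OF assms(1), of b]
      inner_matrix_vector_transpose[of "u b" Z "P *v (b - transpose Z *v u b)"]
    by (simp add: u_def)
  then show ?thesis
    by (simp add: transpose_filt_vec u_def inner_diff_left)
qed

lemma ric_quad:
  assumes "pos_semidef P"
  shows "x \<bullet> (ric P *v x) = step_cost P x (opt_ctrl P x)"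
proof -
  have "x \<bullet> (ric P *v x) =
      (transpose T *v x) \<bullet> (P *v (transpose (filt P) *v (transpose T *v x))) + x \<bullet> (W *v x)"
    unfolding ric_def matrix_vector_mult_add_rdistrib inner_add_right
      inner_matrix_vector_transpose[of x T, symmetric]
    by (simp add: matrix_vector_mul_assoc matrix_mul_assoc)
  then show ?thesis
    unfolding filt_quad[OF assms] by (simp add: step_cost_def opt_ctrl_def)
qed

lemma ric_quad_closed_loop:
  assumes "pos_semidef P"
  shows "x \<bullet> (ric P *v x) = x \<bullet> (W *v x) + opt_ctrl P x \<bullet> (S *v opt_ctrl P x) +
    (transpose (closed_loop P) *v x) \<bullet> (P *v (transpose (closed_loop P) *v x))"
  unfolding ric_quad[OF assms] step_cost_def transpose_closed_loop_vec ..

text \<open>Completing the square: with \<open>u = u0 + h\<close> the terms linear in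
  \<open>h\<close> cancel by the first-order condition, and the excess cost is the form of
  \<open>innov_cov P\<close> at \<open>h\<close>.\<close>

lemma ric_quad_le_step_cost:
  assumes P: "pos_semidef P"
  shows "x \<bullet> (ric P *v x) \<le> step_cost P x u"
proof -
  define u0 where "u0 = opt_ctrl P x"
  define c where "c = transpose T *v x - transpose Z *v u0"
  define h where "h = u - u0"
  have u: "u = u0 + h" by (simp add: h_def)
  have sym: "transpose P = P" using P by (simp add: pos_semidef_def)
  have c': "transpose T *v x - transpose Z *v u = c - transpose Z *v h"
    by (simp add: c_def u matrix_vector_right_distrib)
  have "(transpose Z *v h) \<bullet> (P *v c) = h \<bullet> (S *v u0)"
    using obs_opt_residual[OF P, of "transpose T *v x"]
    by (simp add: inner_matrix_vector_transpose[of h Z, symmetric] c_def u0_def opt_ctrl_def)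
  moreover have "c \<bullet> (P *v (transpose Z *v h)) = (transpose Z *v h) \<bullet> (P *v c)"
    by (rule sym_quad_commute[OF sym])
  moreover have "u0 \<bullet> (S *v h) = h \<bullet> (S *v u0)"
    by (rule sym_quad_commute[OF S_sym])
  ultimately have "step_cost P x u = step_cost P x u0 + h \<bullet> (innov_cov P *v h)"
    unfolding step_cost_def c' innov_cov_quad
    by (simp add: c_def[symmetric] u matrix_vector_right_distrib matrix_vector_mult_diff_distrib
        inner_add_left inner_add_right inner_diff_left inner_diff_right)
  moreover have "h \<bullet> (innov_cov P *v h) \<ge> 0"
    by (rule pos_semidef_quad_nonneg[OF pos_def_imp_pos_semidef[OF innov_cov_pos_def[OF P]]])
  ultimately show ?thesis
    by (simp add: ric_quad[OF P] u0_def)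
qed

lemma step_cost_nonneg: "pos_semidef P \<Longrightarrow> 0 \<le> step_cost P x u"
  unfolding step_cost_def
  by (intro add_nonneg_nonneg pos_semidef_quad_nonneg W_pos_semidef
      pos_def_imp_pos_semidef[OF S_pos_def])

lemma ric_pos_semidef:
  assumes P: "pos_semidef P"
  shows "pos_semidef (ric P)"
  unfolding pos_semidef_def
proof
  have "transpose P = P" using P by (simp add: pos_semidef_def)
  then have "transpose (ric P) = T ** (filt P ** P) ** transpose T + W"
    by (simp add: ric_def transpose_add matrix_transpose_mul W_sym matrix_mul_assoc)
  also have "\<dots> = ric P"
    by (simp add: ric_def filt_sym[OF P, symmetric] matrix_mul_assoc)
  finally show "transpose (ric P) = ric P" .
  show "\<forall>x. 0 \<le> x \<bullet> (ric P *v x)"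
    using step_cost_nonneg[OF P] by (simp add: ric_quad[OF P])
qed

text \<open>Applying \<open>filt P\<close> on the left of \<open>P\<close> and
  \<open>transpose (filt Q)\<close> on the right of \<open>Q\<close> produces the same correction
  \<open>gain P ** S ** transpose (gain Q)\<close> in both products, so it drops out of the
  difference. The mixed form, with one closed loop of each kind, makes the identity exact.\<close>

lemma ric_diff:
  assumes P: "pos_semidef P" and Q: "pos_semidef Q"
  shows "ric P - ric Q = closed_loop P ** (P - Q) ** transpose (closed_loop Q)"
proof -
  have symQ: "transpose Q = Q" using Q by (simp add: pos_semidef_def)
  have 1: "filt P ** P ** transpose Z ** transpose (gain Q) = gain P ** S ** transpose (gain Q)"
    by (simp add: filt_mult_transpose[OF P])
  have "Z ** Q ** transpose (filt Q) = S ** transpose (gain Q)"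
    using arg_cong[OF filt_mult_transpose[OF Q], of transpose] symQ
    by (simp add: matrix_transpose_mul S_sym matrix_mul_assoc)
  then have 2: "gain P ** (Z ** Q ** transpose (filt Q)) = gain P ** S ** transpose (gain Q)"
    by (simp add: matrix_mul_assoc)
  have "filt P ** P ** transpose (filt Q) = filt P ** P - gain P ** S ** transpose (gain Q)"
    unfolding 1[symmetric]
    by (simp add: filt_def[of Q] transpose_diff matrix_transpose_mul matrix_mult_diff_right
        matrix_mul_assoc)
  moreover have "filt P ** Q ** transpose (filt Q) =
      Q ** transpose (filt Q) - gain P ** S ** transpose (gain Q)"
    unfolding 2[symmetric]
    by (simp add: filt_def[of P] matrix_mult_diff_left matrix_mul_assoc)
  ultimately have "filt P ** (P - Q) ** transpose (filt Q) = P ** transpose (filt P) - Q ** transpose (filt Q)"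
    by (simp add: matrix_mult_diff_right matrix_mult_diff_left filt_sym[OF P])
  then have "T ** (filt P ** (P - Q) ** transpose (filt Q)) ** transpose T =
      T ** (P ** transpose (filt P) - Q ** transpose (filt Q)) ** transpose T" by simp
  then show ?thesis
    by (simp add: ric_def closed_loop_def matrix_transpose_mul matrix_mul_assoc
        matrix_mult_diff_right matrix_mult_diff_left)
qed

text \<open>Expresses convergence of the gain without continuity of the matrix inverse.\<close>

lemma gain_diff:
  assumes P: "pos_semidef P" and Q: "pos_semidef Q"
  shows "gain P - gain Q = filt P ** (P - Q) ** transpose Z ** matrix_inv (innov_cov Q)"
proof -
  have "filt P ** Q ** transpose Z = Q ** transpose Z - gain P ** (innov_cov Q - S)"
    by (simp add: filt_def innov_cov_def matrix_mult_diff_left matrix_mul_assoc)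
  also have "\<dots> = gain Q ** innov_cov Q - gain P ** innov_cov Q + gain P ** S"
    by (simp add: matrix_mult_diff_right gain_innov_cov[OF Q])
  finally have "filt P ** (P - Q) ** transpose Z = (gain P - gain Q) ** innov_cov Q"
    by (simp add: matrix_mult_diff_right matrix_mult_diff_left filt_mult_transpose[OF P])
  then have "filt P ** (P - Q) ** transpose Z ** matrix_inv (innov_cov Q) =
      (gain P - gain Q) ** (innov_cov Q ** matrix_inv (innov_cov Q))"
    by (simp add: matrix_mul_assoc)
  then show ?thesis by (simp add: matrix_inv_innov_cov(1)[OF Q])
qed

end

subsection \<open>Convergence of the Riccati recursion\<close>

text \<open>The rank conditions in dual form. \<open>observable\<close>: inputs over
  \<open>n\<close> steps can produce any state. \<open>controllable\<close>: no nonzero state moves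
  freely for \<open>n\<close> steps without cost in \<open>W\<close>.\<close>

locale riccati_sequence = riccati Z T S W
  for Z :: "real^'p^'d" and T :: "real^'p^'p" and S :: "real^'d^'d" and W :: "real^'p^'p" +
  fixes P :: "nat \<Rightarrow> real^'p^'p" and n :: nat
  assumes P_0: "pos_semidef (P 0)"
    and P_Suc: "P (Suc t) = ric (P t)"
    and n_pos: "n > 0"
    and observable: "\<exists>w. x = (\<Sum>k<n. mat_pow (transpose T) k *v (transpose Z *v w k))"
    and controllable: "(\<And>k. k < n \<Longrightarrow> (mat_pow (transpose T) k *v x) \<bullet> (W *v (mat_pow (transpose T) k *v x)) = 0)
      \<Longrightarrow> x = 0"
begin

lemma P_pos_semidef: "pos_semidef (P t)"
  by (induction t) (simp_all add: P_0 P_Suc ric_pos_semidef)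

lemma ric_funpow_pos_semidef: "pos_semidef Q \<Longrightarrow> pos_semidef ((ric ^^ m) Q)"
  by (induction m) (simp_all add: ric_pos_semidef)

lemma P_add: "P (s + m) = (ric ^^ m) (P s)"
  by (induction m) (simp_all add: P_Suc)

text \<open>A control steering \<open>x\<close> to zero in \<open>m\<close> steps costs the same whatever the terminal weight is.\<close>

lemma deadbeat_bound:
  assumes "mat_pow (transpose T) m *v x = (\<Sum>k<m. mat_pow (transpose T) k *v (transpose Z *v w k))"
  shows "\<exists>B. \<forall>Q. pos_semidef Q \<longrightarrow> x \<bullet> ((ric ^^ m) Q *v x) \<le> B"
  using assms
proof (induction m arbitrary: x)
  case 0
  then show ?case by auto
next
  case (Suc m)
  \<comment> \<open>An input applied with \<open>k\<close> steps left is carried by the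
    \<open>k\<close>-th power of \<open>transpose T\<close>, so \<open>w m\<close> is spent first
    and \<open>w 0\<close> last. At the end the state is 0 and any terminal weight costs
    nothing.\<close>
  define y where "y = transpose T *v x - transpose Z *v w m"
  have "mat_pow (transpose T) m *v y = (\<Sum>k<m. mat_pow (transpose T) k *v (transpose Z *v w k))"
    using Suc.prems unfolding mat_pow_Suc_right
    by (simp add: y_def matrix_vector_mult_diff_distrib flip: matrix_vector_mul_assoc)
  from Suc.IH[OF this] obtain B where
    B: "\<And>Q. pos_semidef Q \<Longrightarrow> y \<bullet> ((ric ^^ m) Q *v y) \<le> B" by blast
  have "x \<bullet> ((ric ^^ Suc m) Q *v x) \<le> x \<bullet> (W *v x) + w m \<bullet> (S *v w m) + B"
    if Q: "pos_semidef Q" for Q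
    using ric_quad_le_step_cost[OF ric_funpow_pos_semidef[OF Q, of m], of x "w m"] B[OF Q]
    by (simp add: step_cost_def flip: y_def)
  then show ?case by blast
qed

text \<open>\<open>P (t + n)\<close> is the \<open>n\<close>-fold Riccati iterate of
  \<open>P t\<close>, and the dead-beat bound is the same for every starting matrix, hence for every
  \<open>t\<close>. Only basis vectors have to be tested; \<open>Bseq_offset\<close> adds the first
  \<open>n\<close> terms.\<close>

lemma P_bounded: "\<exists>B>0. \<forall>t. norm (P t) \<le> B"
proof -
  have "\<exists>B. \<forall>Q. pos_semidef Q \<longrightarrow> x \<bullet> ((ric ^^ n) Q *v x) \<le> B" for x
    using observable[of "mat_pow (transpose T) n *v x"] deadbeat_bound by blast
  then obtain B where B: "\<And>x t. x \<bullet> (P (t + n) *v x) \<le> B x"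
    using P_pos_semidef P_add by metis
  define B' where "B' = Max (range (\<lambda>i. B (axis i 1)))"
  have B': "axis i 1 \<bullet> (P (t + n) *v axis i 1) \<le> B'" for i t
    by (rule order_trans[OF B]) (auto simp: B'_def)
  have "Bseq (\<lambda>t. P (t + n))"
    by (rule BseqI'[of _ "real CARD('p) * (real CARD('p) * B')"])
      (intro norm_matrix_le_entries pos_semidef_entry_le[OF P_pos_semidef B'])
  then have "Bseq P" by (rule Bseq_offset)
  then show ?thesis unfolding Bseq_def by blast
qed

text \<open>The vector \<open>u = transpose (gain P) *v b\<close> solves
  \<open>innov_cov P *v u = Z *v (P *v b)\<close>. Pairing with \<open>u\<close> and dropping the
  nonnegative \<open>P\<close> term leaves coercivity of \<open>S\<close> against Cauchy-Schwarz, so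
  no inverse has to be estimated.\<close>

lemma gain_bounded: "\<exists>B. \<forall>t. norm (gain (P t)) \<le> B"
proof -
  obtain c where c: "c > 0" "\<And>u. c * (norm u)\<^sup>2 \<le> u \<bullet> (S *v u)"
    using pos_def_coercive[OF S_pos_def] by blast
  obtain B where B: "B > 0" "\<And>t. norm (P t) \<le> B" using P_bounded by blast
  have "norm (transpose (gain (P t)) *v b) \<le> (norm Z * B / c) * norm b" for t b
  proof -
    define u where "u = transpose (gain (P t)) *v b"
    have "innov_cov (P t) *v u = Z *v (P t *v b)"
      by (simp add: u_def matrix_vector_mul_assoc innov_cov_transpose_gain[OF P_pos_semidef])
    then have "c * (norm u)\<^sup>2 \<le> u \<bullet> (Z *v (P t *v b))"
      using c(2)[of u] innov_cov_quad[of u "P t"]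
        pos_semidef_quad_nonneg[OF P_pos_semidef, of "transpose Z *v u" t] by simp
    also have "\<dots> \<le> norm u * norm (Z *v (P t *v b))" by (rule norm_cauchy_schwarz)
    also have "\<dots> \<le> norm u * (norm Z * (norm (P t) * norm b))"
      by (intro mult_left_mono order_trans[OF norm_matrix_vector_le] norm_matrix_vector_le) auto
    also have "\<dots> \<le> norm u * (norm Z * (B * norm b))"
      by (intro mult_left_mono mult_right_mono B) auto
    finally have "norm u * (c * norm u) \<le> norm u * (norm Z * (B * norm b))"
      by (simp add: power2_eq_square ac_simps)
    then have "c * norm u \<le> norm Z * (B * norm b)"
      using B(1) by (cases "u = 0") auto
    then show ?thesis using c(1) by (simp add: u_def field_simps)
  qed
  then have "norm (transpose (gain (P t))) \<le> real CARD('d) * (real CARD('p) * (norm Z * B / c))" for t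
    by (rule norm_matrix_le_of_bound)
  then show ?thesis by (auto simp: norm_transpose)
qed

lemma filt_bounded: "\<exists>B. \<forall>t. norm (filt (P t)) \<le> B"
proof -
  obtain B where B: "\<And>t. norm (gain (P t)) \<le> B" using gain_bounded by blast
  have "norm (filt (P t)) \<le> norm (mat 1 :: real^'p^'p) + B * norm Z" for t
    unfolding filt_def
    by (intro order_trans[OF norm_triangle_ineq4] add_left_mono order_trans[OF norm_matrix_mult_le]
        mult_right_mono B) auto
  then show ?thesis by blast
qed

text \<open>A bound of at least 1 has increasing powers, which \<open>trans_mat_bound\<close>
  exploits.\<close>

lemma closed_loop_bounded: "\<exists>B\<ge>1. \<forall>t. norm (closed_loop (P t)) \<le> B"
proof -
  obtain B where B: "\<And>t. norm (filt (P t)) \<le> B" using filt_bounded by blast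
  have "norm (closed_loop (P t)) \<le> max 1 (norm T * B)" for t
    unfolding closed_loop_def
    by (rule max.coboundedI2) (intro order_trans[OF norm_matrix_mult_le] mult_left_mono B norm_ge_zero)
  then show ?thesis by (meson max.cobounded1)
qed

section \<open>State transition matrices and their exponential decay\<close>

primrec trans_mat :: "nat \<Rightarrow> nat \<Rightarrow> real^'p^'p" where
  "trans_mat s 0 = mat 1"
| "trans_mat s (Suc k) = closed_loop (P (s + k)) ** trans_mat s k"

lemma trans_mat_add: "trans_mat s (j + k) = trans_mat (s + j) k ** trans_mat s j"
  by (induction k) (simp_all add: matrix_mul_assoc add.assoc)

text \<open>An energy balance. Along the optimal controls,
  \<open>x \<bullet> (P (s + k) *v x)\<close> is the cost of \<open>k\<close> steps plus the energy
  left at the end; those same controls are admissible for terminal weight 0, so their cost is at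
  least the minimal one, given by \<open>(ric ^^ k) 0\<close>.\<close>

lemma trans_mat_energy:
  "(transpose (trans_mat s k) *v x) \<bullet> (P s *v (transpose (trans_mat s k) *v x)) +
     x \<bullet> ((ric ^^ k) 0 *v x) \<le> x \<bullet> (P (s + k) *v x)"
proof (induction k arbitrary: x)
  case (Suc k)
  define A where "A = closed_loop (P (s + k))"
  define u where "u = opt_ctrl (P (s + k)) x"
  define y where "y = transpose A *v x"
  have *: "transpose (trans_mat s (Suc k)) *v x = transpose (trans_mat s k) *v y"
    by (simp add: A_def y_def matrix_transpose_mul matrix_vector_mul_assoc)
  have "x \<bullet> ((ric ^^ Suc k) 0 *v x) \<le> step_cost ((ric ^^ k) 0) x u"
    using ric_quad_le_step_cost[OF ric_funpow_pos_semidef[OF pos_semidef_0]] by simp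
  also have "\<dots> = x \<bullet> (W *v x) + u \<bullet> (S *v u) + y \<bullet> ((ric ^^ k) 0 *v y)"
    by (simp add: step_cost_def u_def y_def A_def transpose_closed_loop_vec)
  finally show ?case
    using Suc.IH[of y] ric_quad_closed_loop[OF P_pos_semidef[of "s + k"], of x]
    unfolding * by (simp add: P_Suc u_def y_def A_def)
qed simp

text \<open>If the minimal cost is zero, each of its nonnegative parts is. Definiteness of
  \<open>S\<close> then forces the control to vanish, so the state moves by
  \<open>transpose T\<close> alone and has no cost in \<open>W\<close> along the way.\<close>

lemma ric_funpow_0_eq_0:
  assumes "x \<bullet> ((ric ^^ m) 0 *v x) = 0" "k < m"
  shows "(mat_pow (transpose T) k *v x) \<bullet> (W *v (mat_pow (transpose T) k *v x)) = 0"
  using assms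
proof (induction m arbitrary: x k)
  case (Suc m)
  define Q where "Q = (ric ^^ m) 0"
  have Q: "pos_semidef Q" unfolding Q_def by (rule ric_funpow_pos_semidef[OF pos_semidef_0])
  define u where "u = opt_ctrl Q x"
  define y where "y = transpose T *v x - transpose Z *v u"
  have "x \<bullet> (W *v x) + u \<bullet> (S *v u) + y \<bullet> (Q *v y) = 0"
    using Suc.prems(1) ric_quad[OF Q, of x] by (simp add: Q_def step_cost_def u_def y_def)
  moreover have "x \<bullet> (W *v x) \<ge> 0" "u \<bullet> (S *v u) \<ge> 0" "y \<bullet> (Q *v y) \<ge> 0"
    by (intro pos_semidef_quad_nonneg W_pos_semidef Q pos_def_imp_pos_semidef[OF S_pos_def])+
  ultimately have *: "x \<bullet> (W *v x) = 0" "u \<bullet> (S *v u) = 0" "y \<bullet> (Q *v y) = 0" by linarith+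
  have "u = 0" using *(2) S_pos_def unfolding pos_def_def by force
  then have y: "y = transpose T *v x" by (simp add: y_def)
  show ?case
  proof (cases k)
    case 0
    then show ?thesis using *(1) by simp
  next
    case (Suc j)
    then have "(mat_pow (transpose T) j *v y) \<bullet> (W *v (mat_pow (transpose T) j *v y)) = 0"
      using Suc.IH[of y j] *(3) Suc.prems(2) by (simp add: Q_def)
    moreover have "mat_pow (transpose T) j *v y = mat_pow (transpose T) k *v x"
      unfolding Suc mat_pow_Suc_right by (simp add: y matrix_vector_mul_assoc)
    ultimately show ?thesis by simp
  qed
qed simp

lemma ric_funpow_0_pos_def: "pos_def ((ric ^^ n) 0)"
proof -
  have *: "pos_semidef ((ric ^^ n) 0)" by (rule ric_funpow_pos_semidef[OF pos_semidef_0])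
  moreover have "x \<bullet> ((ric ^^ n) 0 *v x) \<noteq> 0" if "x \<noteq> 0" for x
    using controllable[of x] ric_funpow_0_eq_0[of x n] that by blast
  ultimately show ?thesis
    unfolding pos_def_def pos_semidef_def by (metis order_le_less)
qed

lemma trans_mat_contraction:
  obtains C \<sigma> where "0 < \<sigma>" "\<sigma> < 1" "0 < C"
    "\<And>s m. n \<le> s \<Longrightarrow> norm (trans_mat s (m * n)) \<le> C * \<sigma> ^ m"
proof -
  let ?q = "\<lambda>s x. x \<bullet> (P s *v x)"
  obtain c where c: "c > 0" "\<And>x. c * (norm x)\<^sup>2 \<le> x \<bullet> ((ric ^^ n) 0 *v x)"
    using pos_def_coercive[OF ric_funpow_0_pos_def] by blast
  obtain B0 where B0: "B0 > 0" "\<And>t. norm (P t) \<le> B0" using P_bounded by blast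
  \<comment> \<open>Adding \<open>c\<close> ensures \<open>B > c\<close>, so that the ratio
    \<open>r\<close> is positive.\<close>
  define B where "B = B0 + c"
  have B: "B > c" "B > 0" "norm (P t) \<le> B" for t using B0(1) B0(2)[of t] c(1) by (auto simp: B_def)
  have upper: "?q s x \<le> B * (norm x)\<^sup>2" for s x
    by (intro order_trans[OF quad_le_norm] mult_right_mono B) auto
  \<comment> \<open>After \<open>n\<close> steps \<open>P s\<close> dominates
    \<open>(ric ^^ n) 0\<close>, whatever the start. This is the source of the restriction
    \<open>n \<le> s\<close>.\<close>
  have lower: "c * (norm x)\<^sup>2 \<le> ?q s x" if "n \<le> s" for s x
    using trans_mat_energy[of "s - n" n x] c(2)[of x] that
      pos_semidef_quad_nonneg[OF P_pos_semidef, of "transpose (trans_mat (s - n) n) *v x" "s - n"]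
    by simp
  \<comment> \<open>The energy lost in \<open>n\<close> steps is at least
    \<open>c * (norm x)\<^sup>2\<close>, which by \<open>upper\<close> is at least the fraction
    \<open>c / B\<close> of the initial energy \<open>?q (s + n) x\<close>.\<close>
  define r where "r = 1 - c / B"
  have r: "0 < r" "r < 1" using B c(1) by (auto simp: r_def field_simps)
  have step: "?q s (transpose (trans_mat s n) *v x) \<le> r * ?q (s + n) x" for s x
  proof -
    have "(c / B) * ?q (s + n) x \<le> (c / B) * (B * (norm x)\<^sup>2)"
      using B c(1) by (intro mult_left_mono upper) auto
    then have "(c / B) * ?q (s + n) x \<le> c * (norm x)\<^sup>2" using B by simp
    then show ?thesis
      using trans_mat_energy[of s n x] c(2)[of x] unfolding r_def left_diff_distrib by linarith
  qed
  have iter: "?q s (transpose (trans_mat s (m * n)) *v x) \<le> r ^ m * ?q (s + m * n) x" for s m x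
  proof (induction m arbitrary: x)
    case (Suc m)
    define y where "y = transpose (trans_mat (s + m * n) n) *v x"
    have "trans_mat s (Suc m * n) = trans_mat (s + m * n) n ** trans_mat s (m * n)"
      using trans_mat_add[of s "m * n" n] by (simp add: add.commute)
    then have "transpose (trans_mat s (Suc m * n)) *v x = transpose (trans_mat s (m * n)) *v y"
      by (simp add: y_def matrix_transpose_mul matrix_vector_mul_assoc)
    then have "?q s (transpose (trans_mat s (Suc m * n)) *v x) \<le> r ^ m * ?q (s + m * n) y"
      using Suc.IH[of y] by simp
    also have "\<dots> \<le> r ^ m * (r * ?q (s + m * n + n) x)"
      unfolding y_def using r by (intro mult_left_mono step) auto
    finally show ?case by (simp add: ac_simps)
  qed simp
  have bound: "norm (transpose (trans_mat s (m * n)) *v x) \<le> (sqrt (B / c) * sqrt r ^ m) * norm x"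
    if "n \<le> s" for s m x
  proof -
    let ?y = "transpose (trans_mat s (m * n)) *v x"
    have "c * (norm ?y)\<^sup>2 \<le> r ^ m * (B * (norm x)\<^sup>2)"
      using r by (intro order_trans[OF lower[OF that]] order_trans[OF iter] mult_left_mono upper) auto
    then have "(norm ?y)\<^sup>2 \<le> (B / c) * r ^ m * (norm x)\<^sup>2"
      using c(1) by (simp add: field_simps)
    then have "norm ?y \<le> sqrt ((B / c) * r ^ m * (norm x)\<^sup>2)" by (rule real_le_rsqrt)
    also have "\<dots> = (sqrt (B / c) * sqrt r ^ m) * norm x"
      unfolding real_sqrt_mult real_sqrt_power by simp
    finally show ?thesis .
  qed
  define C where "C = real CARD('p) * (real CARD('p) * sqrt (B / c))"
  have "norm (trans_mat s (m * n)) \<le> C * sqrt r ^ m" if "n \<le> s" for s m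
    using norm_matrix_le_of_bound[OF bound[OF that]] by (simp add: C_def norm_transpose ac_simps)
  moreover have "0 < sqrt r" "sqrt r < 1" using r by auto
  moreover have "C > 0" using B c(1) by (simp add: C_def)
  ultimately show thesis using that by blast
qed

text \<open>Removes the two restrictions of \<open>trans_mat_contraction\<close>, late starting
  times and lengths divisible by \<open>n\<close>, by splitting off fewer than \<open>2 * n\<close>
  factors that are bounded crudely.\<close>

lemma trans_mat_bound:
  obtains C \<rho> where "0 < \<rho>" "\<rho> < 1" "0 < C" "\<And>s k. norm (trans_mat s k) \<le> C * \<rho> ^ k"
proof -
  obtain C0 \<sigma> where C0: "0 < \<sigma>" "\<sigma> < 1" "0 < C0"
    "\<And>s m. n \<le> s \<Longrightarrow> norm (trans_mat s (m * n)) \<le> C0 * \<sigma> ^ m"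
    using trans_mat_contraction by metis
  obtain D where D: "D \<ge> 1" "\<And>t. norm (closed_loop (P t)) \<le> D" using closed_loop_bounded by blast
  define I where "I = norm (mat 1 :: real^'p^'p)"
  have crude: "norm (trans_mat s k) \<le> I * D ^ k" for s k
  proof (induction k)
    case (Suc k)
    have "norm (trans_mat s (Suc k)) \<le> norm (closed_loop (P (s + k))) * norm (trans_mat s k)"
      by (simp add: norm_matrix_mult_le)
    also have "\<dots> \<le> D * (I * D ^ k)" using D Suc by (intro mult_mono) auto
    finally show ?case by (simp add: ac_simps)
  qed (simp add: I_def)
  define E where "E = I * D ^ (2 * n)"
  have "I > 0" unfolding I_def by (simp add: mat_def vec_eq_iff)
  then have E: "E > 0" using D(1) by (simp add: E_def)
  have E': "norm (trans_mat s k) \<le> E" if "k \<le> 2 * n" for s k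
    using that D(1) \<open>I > 0\<close> unfolding E_def
    by (intro order_trans[OF crude] mult_left_mono power_increasing) auto
  define \<rho> where "\<rho> = root n \<sigma>"
  have \<rho>: "0 < \<rho>" "\<rho> < 1" "\<rho> ^ n = \<sigma>" using C0 n_pos by (auto simp: \<rho>_def)
  \<comment> \<open>The division by a power of \<rho> pays for the factors without decay;
    \<open>1 + C0\<close> serves both cases, being at least 1 and at least
    \<open>C0\<close>.\<close>
  define C where "C = E * (1 + C0) / \<rho> ^ (2 * n)"
  have "norm (trans_mat s k) \<le> C * \<rho> ^ k" for s k
  proof (cases "k < n")
    case True
    have "E * \<rho> ^ (2 * n) \<le> E * (1 + C0) * \<rho> ^ k"
      using E C0 \<rho> True by (intro mult_mono power_decreasing) auto
    then have "E \<le> C * \<rho> ^ k" using \<rho> by (simp add: C_def field_simps)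
    then show ?thesis using E'[of k s] True by simp
  next
    case False
    \<comment> \<open>The first \<open>n + j\<close> factors move the starting time to at least
      \<open>n\<close> and leave a multiple of \<open>n\<close>.\<close>
    define j m where "j = (k - n) mod n" and "m = (k - n) div n"
    have j: "j < n" using n_pos by (simp add: j_def)
    have "m * n + j = k - n" by (simp add: j_def m_def)
    then have k: "k = (n + j) + m * n" using False by linarith
    have "norm (trans_mat s k) \<le> norm (trans_mat (s + (n + j)) (m * n)) * norm (trans_mat s (n + j))"
      unfolding k trans_mat_add by (rule norm_matrix_mult_le)
    also have "\<dots> \<le> (C0 * \<sigma> ^ m) * E"
      using C0 E j by (intro mult_mono C0(4) E') auto
    finally have 1: "norm (trans_mat s k) \<le> (C0 * \<sigma> ^ m) * E" .
    have "\<sigma> ^ m * \<rho> ^ (2 * n) = \<rho> ^ (m * n + 2 * n)"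
      by (simp add: \<rho>(3)[symmetric] power_add mult.commute flip: power_mult)
    also have "\<dots> \<le> \<rho> ^ k" using \<rho> j k by (intro power_decreasing) auto
    finally have "\<sigma> ^ m \<le> \<rho> ^ k / \<rho> ^ (2 * n)" using \<rho> by (simp add: field_simps)
    then have "(C0 * \<sigma> ^ m) * E \<le> ((1 + C0) * (\<rho> ^ k / \<rho> ^ (2 * n))) * E"
      using C0 E by (intro mult_right_mono mult_mono) auto
    with 1 show ?thesis by (simp add: C_def ac_simps)
  qed
  moreover have "C > 0" using E C0 \<rho> by (simp add: C_def)
  ultimately show thesis using that \<rho> by blast
qed

text \<open>\<open>P (Suc k)\<close> and \<open>P k\<close> are \<open>k\<close>-fold iterates from
  \<open>P 1\<close> and \<open>P 0\<close>. By \<open>ric_diff\<close> their difference is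
  \<open>P 1 - P 0\<close> between two transition matrices, so the increments are summable like
  powers of \<rho> squared.\<close>

lemma P_convergent: "\<exists>L. P \<longlonglongrightarrow> L"
proof -
  obtain C \<rho> where C: "0 < \<rho>" "\<rho> < 1" "0 < C" "\<And>s k. norm (trans_mat s k) \<le> C * \<rho> ^ k"
    using trans_mat_bound by metis
  have diff: "P (Suc k) - P k = trans_mat 1 k ** (P 1 - P 0) ** transpose (trans_mat 0 k)" for k
  proof (induction k)
    case (Suc k)
    have "P (Suc (Suc k)) - P (Suc k) = ric (P (Suc k)) - ric (P k)" by (simp add: P_Suc)
    also have "\<dots> = closed_loop (P (Suc k)) ** (P (Suc k) - P k) ** transpose (closed_loop (P k))"
      by (intro ric_diff P_pos_semidef)
    finally show ?case by (simp add: Suc matrix_transpose_mul matrix_mul_assoc)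
  qed simp
  have bound: "norm (P (Suc k) - P k) \<le> (C * C * norm (P 1 - P 0)) * (\<rho>\<^sup>2) ^ k" for k
  proof -
    have "norm (P (Suc k) - P k) \<le> norm (trans_mat 1 k) * norm (P 1 - P 0) * norm (trans_mat 0 k)"
      unfolding diff
      using norm_matrix_mult3_le[of "trans_mat 1 k" "P 1 - P 0" "transpose (trans_mat 0 k)"]
      by (simp add: norm_transpose)
    also have "\<dots> \<le> (C * \<rho> ^ k) * norm (P 1 - P 0) * (C * \<rho> ^ k)"
      using C by (intro mult_mono C(4)) auto
    also have "\<dots> = (C * C * norm (P 1 - P 0)) * (\<rho>\<^sup>2) ^ k"
      by (simp add: power2_eq_square power_mult_distrib)
    finally show ?thesis .
  qed
  have "summable (\<lambda>k. (C * C * norm (P 1 - P 0)) * (\<rho>\<^sup>2) ^ k)"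
    using C by (intro summable_mult summable_geometric) (simp add: power_less_one_iff)
  from summable_comparison_test'[OF this bound]
  have "summable (\<lambda>k. P (Suc k) - P k)" .
  from summable_LIMSEQ[OF this] have "(\<lambda>k. P k - P 0) \<longlonglongrightarrow> (\<Sum>k. P (Suc k) - P k)"
    by (simp add: sum_lessThan_telescope)
  from tendsto_add[OF this tendsto_const[of "P 0"]] show ?thesis by auto
qed

lemma gain_convergent: "\<exists>K. (\<lambda>t. gain (P t)) \<longlonglongrightarrow> K"
proof -
  obtain L where L: "P \<longlonglongrightarrow> L" using P_convergent by blast
  \<comment> \<open>Semidefiniteness survives in the limit, which makes \<open>innov_cov L\<close>
    invertible and \<open>gain_diff\<close> applicable at \<open>L\<close>.\<close>
  have psd: "pos_semidef L" by (rule pos_semidef_tendsto[OF L P_pos_semidef])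
  obtain B where B: "\<And>t. norm (filt (P t)) \<le> B" using filt_bounded by blast
  let ?I = "matrix_inv (innov_cov L)"
  have "norm (gain (P t) - gain L) \<le> B * norm (P t - L) * norm Z * norm ?I" for t
  proof -
    have "norm (gain (P t) - gain L) \<le> norm (filt (P t)) * norm (P t - L) * norm Z * norm ?I"
      unfolding gain_diff[OF P_pos_semidef psd]
      using norm_matrix_mult3_le[of "filt (P t)" "P t - L" "transpose Z"]
      by (intro order_trans[OF norm_matrix_mult_le mult_right_mono]) (auto simp: norm_transpose)
    also have "\<dots> \<le> B * norm (P t - L) * norm Z * norm ?I"
      by (intro mult_right_mono B) auto
    finally show ?thesis .
  qed
  then have "\<forall>\<^sub>F t in sequentially. norm (gain (P t) - gain L) \<le> B * norm (P t - L) * norm Z * norm ?I"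
    by simp
  moreover have "(\<lambda>t. B * norm (P t - L) * norm Z * norm ?I) \<longlonglongrightarrow> B * norm (L - L) * norm Z * norm ?I"
    by (intro tendsto_intros L)
  then have "(\<lambda>t. B * norm (P t - L) * norm Z * norm ?I) \<longlonglongrightarrow> 0" by simp
  ultimately have "(\<lambda>t. gain (P t) - gain L) \<longlonglongrightarrow> 0"
    by (rule Lim_null_comparison)
  from LIM_zero_cancel[OF this] show ?thesis by (rule exI)
qed

end

subsection \<open>Moments in a Gaussian family\<close>

context prob_space
begin

definition covar :: "('a \<Rightarrow> real) \<Rightarrow> ('a \<Rightarrow> real) \<Rightarrow> real" where
  "covar X Y = expectation (\<lambda>\<omega>. (X \<omega> - expectation X) * (Y \<omega> - expectation Y))"

lemma covar_commute: "covar X Y = covar Y X"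
  by (simp add: covar_def mult.commute)

lemma covar_cong:
  assumes "\<And>\<omega>. \<omega> \<in> space M \<Longrightarrow> X \<omega> = X' \<omega>" "\<And>\<omega>. \<omega> \<in> space M \<Longrightarrow> Y \<omega> = Y' \<omega>"
  shows "covar X Y = covar X' Y'"
proof -
  have "expectation X = expectation X'" "expectation Y = expectation Y'"
    using assms by (auto intro!: Bochner_Integration.integral_cong)
  then show ?thesis
    unfolding covar_def using assms by (auto intro!: Bochner_Integration.integral_cong)
qed

lemma covar_const: "covar X (\<lambda>\<omega>. k) = 0"
  by (simp add: covar_def prob_space)

text \<open>The point mass obeys the same formulas with \<open>s = 0\<close>, so the degenerate case
  needs no separate treatment later.\<close>

lemma normal_rv_moments:
  assumes "normal_rv Y m s"
  shows "integrable M (\<lambda>\<omega>. (Y \<omega> - m) ^ n)" "integrable M Y" "expectation Y = m"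
    "expectation (\<lambda>\<omega>. (Y \<omega> - m)\<^sup>2) = s" "expectation (\<lambda>\<omega>. (Y \<omega> - m) ^ 4) = 3 * s\<^sup>2"
proof -
  have meas [measurable]: "Y \<in> borel_measurable M" using assms by (simp add: normal_rv_def)
  consider "s = 0" "AE \<omega> in M. Y \<omega> = m" | "s > 0" "distributed M lborel Y (normal_density m (sqrt s))"
    using assms by (auto simp: normal_rv_def)
  then have "integrable M (\<lambda>\<omega>. (Y \<omega> - m) ^ n) \<and> integrable M Y \<and> expectation Y = m \<and>
    expectation (\<lambda>\<omega>. (Y \<omega> - m)\<^sup>2) = s \<and> expectation (\<lambda>\<omega>. (Y \<omega> - m) ^ 4) = 3 * s\<^sup>2"
  proof cases
    case 1
    have int: "integrable M (\<lambda>\<omega>. (Y \<omega> - m) ^ n) \<longleftrightarrow> integrable M (\<lambda>\<omega>. 0 ^ n :: real)" for n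
      using 1(2) by (intro integrable_cong_AE) auto
    have eq: "expectation (\<lambda>\<omega>. (Y \<omega> - m) ^ n) = expectation (\<lambda>\<omega>. 0 ^ n)" for n
      using 1(2) by (intro integral_cong_AE) auto
    have "integrable M Y \<longleftrightarrow> integrable M (\<lambda>\<omega>. m)" using 1(2) by (intro integrable_cong_AE) auto
    moreover have "expectation Y = expectation (\<lambda>\<omega>. m)" using 1(2) by (intro integral_cong_AE) auto
    ultimately show ?thesis using int eq 1(1) by (auto simp: prob_space)
  next
    case 2
    then have \<sigma>: "sqrt s > 0" by simp
    note int = distributed_integrable[OF 2(2)] and eq = distributed_integral[OF 2(2)]
    have "integrable M (\<lambda>\<omega>. (Y \<omega> - m) ^ n)"
      using int[of "\<lambda>x. (x - m) ^ n"] integrable_normal_moment[OF \<sigma>] by simp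
    moreover have "integrable M Y"
      using int[of "\<lambda>x. x"] integrable_normal_moment_nz_1[OF \<sigma>] by simp
    moreover have "expectation Y = m"
      using eq[of "\<lambda>x. x"] integral_normal_moment_nz_1[OF \<sigma>, of m] by simp
    moreover have "expectation (\<lambda>\<omega>. (Y \<omega> - m)\<^sup>2) = s"
      using eq[of "\<lambda>x. (x - m)\<^sup>2"] integral_normal_moment_even[OF \<sigma>, of m 1] 2(1) by simp
    moreover have "expectation (\<lambda>\<omega>. (Y \<omega> - m) ^ 4) = 3 * s\<^sup>2"
      using eq[of "\<lambda>x. (x - m) ^ 4"] integral_normal_moment_even[OF \<sigma>, of m 2] 2(1)
      by (simp add: fact_numeral power2_eq_square)
    ultimately show ?thesis by blast
  qed
  then show "integrable M (\<lambda>\<omega>. (Y \<omega> - m) ^ n)" "integrable M Y" "expectation Y = m"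
    "expectation (\<lambda>\<omega>. (Y \<omega> - m)\<^sup>2) = s" "expectation (\<lambda>\<omega>. (Y \<omega> - m) ^ 4) = 3 * s\<^sup>2"
    by blast+
qed

end

locale gaussian_family = prob_space M for M :: "'a measure" +
  fixes S :: "('a \<Rightarrow> real) set"
  assumes gaussian: "jointly_gaussian S"
begin

text \<open>The affine span of \<open>S\<close>. Constants are included because the filter starts
  from a deterministic vector, and equality is asked only on \<open>space M\<close> because the
  model equations hold only there.\<close>

definition gspan :: "('a \<Rightarrow> real) set" where
  "gspan = {X. \<exists>F c k. finite F \<and> F \<subseteq> S \<and> (\<forall>\<omega>\<in>space M. X \<omega> = k + (\<Sum>b\<in>F. c b * b \<omega>))}"

lemma gspan_cong: "X \<in> gspan \<Longrightarrow> (\<And>\<omega>. \<omega> \<in> space M \<Longrightarrow> Y \<omega> = X \<omega>) \<Longrightarrow> Y \<in> gspan"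
  unfolding gspan_def by fastforce

lemma gspan_base: "b \<in> S \<Longrightarrow> b \<in> gspan"
  unfolding gspan_def by (auto intro!: exI[of _ "{b}"] exI[of _ "\<lambda>_. 1"] exI[of _ 0])

lemma gspan_const: "(\<lambda>\<omega>. k) \<in> gspan"
  unfolding gspan_def by (auto intro!: exI[of _ "{}"])

lemma gspan_add:
  assumes "X \<in> gspan" "Y \<in> gspan"
  shows "(\<lambda>\<omega>. X \<omega> + Y \<omega>) \<in> gspan"
proof -
  obtain F c k where F: "finite F" "F \<subseteq> S" "\<And>\<omega>. \<omega> \<in> space M \<Longrightarrow> X \<omega> = k + (\<Sum>b\<in>F. c b * b \<omega>)"
    using assms(1) unfolding gspan_def by blast
  obtain G d l where G: "finite G" "G \<subseteq> S" "\<And>\<omega>. \<omega> \<in> space M \<Longrightarrow> Y \<omega> = l + (\<Sum>b\<in>G. d b * b \<omega>)"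
    using assms(2) unfolding gspan_def by blast
  let ?c = "\<lambda>b. (if b \<in> F then c b else 0) + (if b \<in> G then d b else 0)"
  have "X \<omega> + Y \<omega> = (k + l) + (\<Sum>b\<in>F \<union> G. ?c b * b \<omega>)" if "\<omega> \<in> space M" for \<omega>
  proof -
    have "(\<Sum>b\<in>F. c b * b \<omega>) = (\<Sum>b\<in>F \<union> G. (if b \<in> F then c b else 0) * b \<omega>)"
      using F(1) G(1) by (intro sum.mono_neutral_cong_left) auto
    moreover have "(\<Sum>b\<in>G. d b * b \<omega>) = (\<Sum>b\<in>F \<union> G. (if b \<in> G then d b else 0) * b \<omega>)"
      using F(1) G(1) by (intro sum.mono_neutral_cong_left) auto
    ultimately show ?thesis
      by (simp add: F(3)[OF that] G(3)[OF that] distrib_right sum.distrib)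
  qed
  then show ?thesis
    unfolding gspan_def using F G
    by (auto intro!: exI[of _ "F \<union> G"] exI[of _ ?c] exI[of _ "k + l"])
qed

lemma gspan_scale:
  assumes "X \<in> gspan"
  shows "(\<lambda>\<omega>. a * X \<omega>) \<in> gspan"
proof -
  obtain F c k where F: "finite F" "F \<subseteq> S" "\<And>\<omega>. \<omega> \<in> space M \<Longrightarrow> X \<omega> = k + (\<Sum>b\<in>F. c b * b \<omega>)"
    using assms unfolding gspan_def by blast
  then show ?thesis
    unfolding gspan_def
    by (auto intro!: exI[of _ F] exI[of _ "\<lambda>b. a * c b"] exI[of _ "a * k"]
        simp: distrib_left sum_distrib_left mult.assoc)
qed

lemma gspan_diff: "X \<in> gspan \<Longrightarrow> Y \<in> gspan \<Longrightarrow> (\<lambda>\<omega>. X \<omega> - Y \<omega>) \<in> gspan"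
  using gspan_add[OF _ gspan_scale[of Y "-1"], of X] by simp

lemma gspan_sum: "(\<And>i. i \<in> I \<Longrightarrow> X i \<in> gspan) \<Longrightarrow> (\<lambda>\<omega>. \<Sum>i\<in>I. X i \<omega>) \<in> gspan"
  by (induction I rule: infinite_finite_induct) (simp_all add: gspan_const gspan_add)

lemma gspan_moments:
  assumes "X \<in> gspan"
  shows "integrable M X" "integrable M (\<lambda>\<omega>. (X \<omega> - expectation X) ^ n)"
    "expectation (\<lambda>\<omega>. (X \<omega> - expectation X) ^ 4) = 3 * (expectation (\<lambda>\<omega>. (X \<omega> - expectation X)\<^sup>2))\<^sup>2"
proof -
  obtain F c k where F: "finite F" "F \<subseteq> S" "\<And>\<omega>. \<omega> \<in> space M \<Longrightarrow> X \<omega> = k + (\<Sum>b\<in>F. c b * b \<omega>)"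
    using assms unfolding gspan_def by blast
  define Y where "Y \<omega> = (\<Sum>b\<in>F. c b * b \<omega>)" for \<omega>
  obtain m s where "normal_rv Y m s"
    using gaussian F(1,2) unfolding jointly_gaussian_def Y_def by blast
  note Y = normal_rv_moments[OF this]
  have eq: "X \<omega> = k + Y \<omega>" if "\<omega> \<in> space M" for \<omega> using F(3)[OF that] by (simp add: Y_def)
  have X: "integrable M X \<longleftrightarrow> integrable M (\<lambda>\<omega>. k + Y \<omega>)" "expectation X = expectation (\<lambda>\<omega>. k + Y \<omega>)"
    using eq by (auto intro!: Bochner_Integration.integrable_cong Bochner_Integration.integral_cong)
  then show "integrable M X" using Y(2) by simp
  have "expectation X = k + m" using X(2) Y(2,3) by (simp add: prob_space)
  then have *: "X \<omega> - expectation X = Y \<omega> - m" if "\<omega> \<in> space M" for \<omega> using eq[OF that] by simp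
  have "expectation (\<lambda>\<omega>. (X \<omega> - expectation X) ^ n) = expectation (\<lambda>\<omega>. (Y \<omega> - m) ^ n)" for n
    using * by (intro Bochner_Integration.integral_cong) auto
  then show "expectation (\<lambda>\<omega>. (X \<omega> - expectation X) ^ 4) = 3 * (expectation (\<lambda>\<omega>. (X \<omega> - expectation X)\<^sup>2))\<^sup>2"
    using Y(4,5) by simp
  have "integrable M (\<lambda>\<omega>. (X \<omega> - expectation X) ^ n) \<longleftrightarrow> integrable M (\<lambda>\<omega>. (Y \<omega> - m) ^ n)"
    using * by (intro Bochner_Integration.integrable_cong) auto
  then show "integrable M (\<lambda>\<omega>. (X \<omega> - expectation X) ^ n)" using Y(1) by blast
qed

lemma gspan_measurable: "X \<in> gspan \<Longrightarrow> X \<in> borel_measurable M"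
  using gspan_moments(1) by blast

text \<open>Isserlis' formula for two variables, derived from one-dimensional fourth moments:
  \<open>x + y\<close> and \<open>x - y\<close> also lie in the span, and the sum of their fourth
  powers contains the mixed term twelve times.\<close>

lemma gspan_centered:
  assumes "X \<in> gspan" "Y \<in> gspan"
  defines "x \<equiv> \<lambda>\<omega>. X \<omega> - expectation X" and "y \<equiv> \<lambda>\<omega>. Y \<omega> - expectation Y"
  shows gspan_centered_mult_integrable: "integrable M (\<lambda>\<omega>. x \<omega> * y \<omega>)"
    and gspan_centered_squares_integrable: "integrable M (\<lambda>\<omega>. (x \<omega>)\<^sup>2 * (y \<omega>)\<^sup>2)"
    and gspan_centered_squares: "expectation (\<lambda>\<omega>. (x \<omega>)\<^sup>2 * (y \<omega>)\<^sup>2) =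
      covar X X * covar Y Y + 2 * (covar X Y)\<^sup>2"
proof -
  define P where "P \<omega> = X \<omega> + Y \<omega>" for \<omega>
  define N where "N \<omega> = X \<omega> - Y \<omega>" for \<omega>
  have G: "P \<in> gspan" "N \<in> gspan"
    using assms by (auto simp: P_def[abs_def] N_def[abs_def] intro: gspan_add gspan_diff)
  note ints = gspan_moments(1)[OF assms(1)] gspan_moments(1)[OF assms(2)]
  have P: "P \<omega> - expectation P = x \<omega> + y \<omega>" and N: "N \<omega> - expectation N = x \<omega> - y \<omega>" for \<omega>
    using ints by (simp_all add: P_def[abs_def] N_def[abs_def] x_def y_def)
  note mX = gspan_moments(2,3)[OF assms(1), folded x_def]
  note mY = gspan_moments(2,3)[OF assms(2), folded y_def]
  note mP = gspan_moments(2,3)[OF G(1), unfolded P]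
  note mN = gspan_moments(2,3)[OF G(2), unfolded N]
  have i: "integrable M (\<lambda>\<omega>. (x \<omega>)\<^sup>2)" "integrable M (\<lambda>\<omega>. (y \<omega>)\<^sup>2)"
    using mX(1)[of 2] mY(1)[of 2] by (simp_all add: x_def y_def)
  have prod: "x \<omega> * y \<omega> = ((x \<omega> + y \<omega>)\<^sup>2 - (x \<omega> - y \<omega>)\<^sup>2) / 4" for \<omega>
    by (simp add: power2_eq_square algebra_simps)
  show int: "integrable M (\<lambda>\<omega>. x \<omega> * y \<omega>)"
    unfolding prod using mP(1)[of 2] mN(1)[of 2] by auto
  have four: "(x \<omega>)\<^sup>2 * (y \<omega>)\<^sup>2 =
      ((x \<omega> + y \<omega>) ^ 4 + (x \<omega> - y \<omega>) ^ 4 - 2 * (x \<omega>) ^ 4 - 2 * (y \<omega>) ^ 4) / 12" for \<omega>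
    by (simp add: power2_eq_square power4_eq_xxxx algebra_simps)
  have i4: "integrable M (\<lambda>\<omega>. (x \<omega>) ^ 4)" "integrable M (\<lambda>\<omega>. (y \<omega>) ^ 4)"
    using mX(1)[of 4] mY(1)[of 4] by (simp_all add: x_def y_def)
  show "integrable M (\<lambda>\<omega>. (x \<omega>)\<^sup>2 * (y \<omega>)\<^sup>2)"
    unfolding four using mP(1)[of 4] mN(1)[of 4] i4 by auto
  define a b c where "a = covar X X" and "b = covar Y Y" and "c = covar X Y"
  have a: "expectation (\<lambda>\<omega>. (x \<omega>)\<^sup>2) = a" and b: "expectation (\<lambda>\<omega>. (y \<omega>)\<^sup>2) = b"
    and c: "expectation (\<lambda>\<omega>. x \<omega> * y \<omega>) = c"
    by (simp_all add: a_def b_def c_def covar_def x_def y_def power2_eq_square)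
  have "expectation (\<lambda>\<omega>. (x \<omega> + y \<omega>)\<^sup>2) = a + 2 * c + b"
    unfolding power2_sum using i int by (simp add: a b c mult.assoc)
  then have p4: "expectation (\<lambda>\<omega>. (x \<omega> + y \<omega>) ^ 4) = 3 * (a + 2 * c + b)\<^sup>2" using mP(2) by simp
  have "expectation (\<lambda>\<omega>. (x \<omega> - y \<omega>)\<^sup>2) = a - 2 * c + b"
    unfolding power2_diff using i int by (simp add: a b c mult.assoc)
  then have n4: "expectation (\<lambda>\<omega>. (x \<omega> - y \<omega>) ^ 4) = 3 * (a - 2 * c + b)\<^sup>2" using mN(2) by simp
  have x4: "expectation (\<lambda>\<omega>. (x \<omega>) ^ 4) = 3 * a\<^sup>2" using mX(2) by (simp add: a[symmetric] x_def)
  have y4: "expectation (\<lambda>\<omega>. (y \<omega>) ^ 4) = 3 * b\<^sup>2" using mY(2) by (simp add: b[symmetric] y_def)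
  have "expectation (\<lambda>\<omega>. (x \<omega>)\<^sup>2 * (y \<omega>)\<^sup>2) = a * b + 2 * c\<^sup>2"
    unfolding four using mP(1)[of 4] mN(1)[of 4] i4
    by (simp add: p4 n4 x4 y4 power2_eq_square algebra_simps)
  then show "expectation (\<lambda>\<omega>. (x \<omega>)\<^sup>2 * (y \<omega>)\<^sup>2) = covar X X * covar Y Y + 2 * (covar X Y)\<^sup>2"
    by (simp add: a_def b_def c_def)
qed

lemma covar_add_left:
  assumes "X \<in> gspan" "Y \<in> gspan" "U \<in> gspan"
  shows "covar (\<lambda>\<omega>. X \<omega> + Y \<omega>) U = covar X U + covar Y U"
proof -
  have "covar (\<lambda>\<omega>. X \<omega> + Y \<omega>) U = expectation (\<lambda>\<omega>.
      (X \<omega> - expectation X) * (U \<omega> - expectation U) + (Y \<omega> - expectation Y) * (U \<omega> - expectation U))"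
    unfolding covar_def using gspan_moments(1)[OF assms(1)] gspan_moments(1)[OF assms(2)]
    by (intro Bochner_Integration.integral_cong) (auto simp: algebra_simps)
  then show ?thesis
    unfolding covar_def
    using gspan_centered_mult_integrable[OF assms(1,3)] gspan_centered_mult_integrable[OF assms(2,3)]
    by simp
qed

lemma covar_scale_left: "covar (\<lambda>\<omega>. a * X \<omega>) U = a * covar X U"
  by (simp add: covar_def mult.assoc flip: right_diff_distrib)

lemma covar_diff_left:
  assumes "X \<in> gspan" "Y \<in> gspan" "U \<in> gspan"
  shows "covar (\<lambda>\<omega>. X \<omega> - Y \<omega>) U = covar X U - covar Y U"
  using covar_add_left[OF assms(1) gspan_scale[OF assms(2), of "-1"] assms(3)]
    covar_scale_left[of "-1" Y U] by simp

lemma covar_sum_left: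
  assumes "\<And>i. i \<in> I \<Longrightarrow> X i \<in> gspan" "U \<in> gspan"
  shows "covar (\<lambda>\<omega>. \<Sum>i\<in>I. X i \<omega>) U = (\<Sum>i\<in>I. covar (X i) U)"
  using assms(1)
proof (induction I rule: infinite_finite_induct)
  case (insert i I)
  then show ?case by (simp add: covar_add_left gspan_sum assms(2))
qed (simp_all add: covar_const covar_commute[of "\<lambda>_. _"])

subsection \<open>Covariance of Gaussian random vectors\<close>

definition gvec :: "('a \<Rightarrow> real^'n) \<Rightarrow> bool" where
  "gvec X \<longleftrightarrow> (\<forall>i. (\<lambda>\<omega>. X \<omega> $ i) \<in> gspan)"

definition mean_vec :: "('a \<Rightarrow> real^'n) \<Rightarrow> real^'n" where
  "mean_vec X = (\<chi> i. expectation (\<lambda>\<omega>. X \<omega> $ i))"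

lemma cross_cov_nth: "cross_cov X Y $ i $ j = covar (\<lambda>\<omega>. X \<omega> $ i) (\<lambda>\<omega>. Y \<omega> $ j)"
  by (simp add: cross_cov_def covar_def)

lemma gvec_nth: "gvec X \<Longrightarrow> (\<lambda>\<omega>. X \<omega> $ i) \<in> gspan"
  by (simp add: gvec_def)

lemma gvec_cong: "gvec X \<Longrightarrow> (\<And>\<omega>. \<omega> \<in> space M \<Longrightarrow> Y \<omega> = X \<omega>) \<Longrightarrow> gvec Y"
  unfolding gvec_def by (auto intro: gspan_cong)

lemma gvec_add: "gvec X \<Longrightarrow> gvec Y \<Longrightarrow> gvec (\<lambda>\<omega>. X \<omega> + Y \<omega>)"
  by (simp add: gvec_def gspan_add)

lemma gvec_diff: "gvec X \<Longrightarrow> gvec Y \<Longrightarrow> gvec (\<lambda>\<omega>. X \<omega> - Y \<omega>)"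
  by (simp add: gvec_def gspan_diff)

lemma gvec_mult: "gvec X \<Longrightarrow> gvec (\<lambda>\<omega>. A *v X \<omega>)"
  by (auto simp: gvec_def matrix_vector_mult_def intro!: gspan_sum gspan_scale)

lemma gvec_const: "gvec (\<lambda>\<omega>. k)"
  by (simp add: gvec_def gspan_const)

lemma mean_vec_cong: "(\<And>\<omega>. \<omega> \<in> space M \<Longrightarrow> X \<omega> = X' \<omega>) \<Longrightarrow> mean_vec X = mean_vec X'"
  unfolding mean_vec_def by (auto simp: vec_eq_iff intro!: Bochner_Integration.integral_cong)

lemma mean_vec_add: "gvec X \<Longrightarrow> gvec Y \<Longrightarrow> mean_vec (\<lambda>\<omega>. X \<omega> + Y \<omega>) = mean_vec X + mean_vec Y"
  by (simp add: vec_eq_iff mean_vec_def gspan_moments(1) gvec_nth)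

lemma mean_vec_diff: "gvec X \<Longrightarrow> gvec Y \<Longrightarrow> mean_vec (\<lambda>\<omega>. X \<omega> - Y \<omega>) = mean_vec X - mean_vec Y"
  by (simp add: vec_eq_iff mean_vec_def gspan_moments(1) gvec_nth)

lemma mean_vec_mult: "gvec X \<Longrightarrow> mean_vec (\<lambda>\<omega>. A *v X \<omega>) = A *v mean_vec X"
  by (simp add: vec_eq_iff mean_vec_def matrix_vector_mult_def gspan_moments(1) gvec_nth)

lemma cross_cov_cong:
  assumes "\<And>\<omega>. \<omega> \<in> space M \<Longrightarrow> X \<omega> = X' \<omega>" "\<And>\<omega>. \<omega> \<in> space M \<Longrightarrow> Y \<omega> = Y' \<omega>"
  shows "cross_cov X Y = cross_cov X' Y'"
  unfolding vec_eq_iff cross_cov_nth using assms by (auto intro!: covar_cong)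

lemma cross_cov_transpose: "cross_cov Y X = transpose (cross_cov X Y)"
  by (simp add: vec_eq_iff cross_cov_nth transpose_def covar_commute)

lemma cross_cov_add_left:
  "gvec X \<Longrightarrow> gvec Y \<Longrightarrow> gvec U \<Longrightarrow> cross_cov (\<lambda>\<omega>. X \<omega> + Y \<omega>) U = cross_cov X U + cross_cov Y U"
  by (simp add: vec_eq_iff cross_cov_nth covar_add_left gvec_nth)

lemma cross_cov_diff_left:
  "gvec X \<Longrightarrow> gvec Y \<Longrightarrow> gvec U \<Longrightarrow> cross_cov (\<lambda>\<omega>. X \<omega> - Y \<omega>) U = cross_cov X U - cross_cov Y U"
  by (simp add: vec_eq_iff cross_cov_nth covar_diff_left gvec_nth)

lemma cross_cov_mult_left:
  assumes "gvec X" "gvec U"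
  shows "cross_cov (\<lambda>\<omega>. A *v X \<omega>) U = A ** cross_cov X U"
  using assms
  by (simp add: vec_eq_iff cross_cov_nth matrix_vector_mult_def matrix_matrix_mult_def
      covar_sum_left covar_scale_left gvec_nth gspan_scale)

lemma cross_cov_const_left: "cross_cov (\<lambda>\<omega>. k) U = 0"
  by (simp add: vec_eq_iff cross_cov_nth covar_const covar_commute[of "\<lambda>_. _"])

lemma cross_cov_add_right:
  "gvec X \<Longrightarrow> gvec Y \<Longrightarrow> gvec U \<Longrightarrow> cross_cov U (\<lambda>\<omega>. X \<omega> + Y \<omega>) = cross_cov U X + cross_cov U Y"
  unfolding cross_cov_transpose[of U X] cross_cov_transpose[of U Y]
    cross_cov_transpose[of U "\<lambda>\<omega>. X \<omega> + Y \<omega>"]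
  by (simp add: cross_cov_add_left transpose_add)

lemma cross_cov_diff_right:
  "gvec X \<Longrightarrow> gvec Y \<Longrightarrow> gvec U \<Longrightarrow> cross_cov U (\<lambda>\<omega>. X \<omega> - Y \<omega>) = cross_cov U X - cross_cov U Y"
  unfolding cross_cov_transpose[of U X] cross_cov_transpose[of U Y]
    cross_cov_transpose[of U "\<lambda>\<omega>. X \<omega> - Y \<omega>"]
  by (simp add: cross_cov_diff_left transpose_diff)

lemma cross_cov_mult_right:
  "gvec X \<Longrightarrow> gvec U \<Longrightarrow> cross_cov U (\<lambda>\<omega>. A *v X \<omega>) = cross_cov U X ** transpose A"
  unfolding cross_cov_transpose[of U X] cross_cov_transpose[of U "\<lambda>\<omega>. A *v X \<omega>"]
  by (simp add: cross_cov_mult_left matrix_transpose_mul)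

end

subsection \<open>Ergodic averages\<close>

lemma cesaro_mean:
  fixes a :: "nat \<Rightarrow> real"
  assumes "a \<longlonglongrightarrow> L"
  shows "(\<lambda>m. (\<Sum>t<m. a t) / real m) \<longlonglongrightarrow> L"
proof (rule LIMSEQ_I)
  fix e :: real assume e: "e > 0"
  then obtain N where N: "\<And>t. t \<ge> N \<Longrightarrow> \<bar>a t - L\<bar> < e / 2"
    using LIMSEQ_D[OF assms, of "e / 2"] by auto
  define B where "B = (\<Sum>t<N. \<bar>a t - L\<bar>)"
  have B: "B \<ge> 0" unfolding B_def by (intro sum_nonneg) auto
  obtain m0 where m0: "2 * B / e < real m0" using reals_Archimedean2 by blast
  have "norm ((\<Sum>t<m. a t) / real m - L) < e" if m: "m \<ge> max (Suc m0) N" for m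
  proof -
    have m': "real m > 0" "N \<le> m" "real m > 2 * B / e" using m m0 by auto
    have "(\<Sum>t<m. a t) / real m - L = (\<Sum>t<m. a t - L) / real m"
      using m' by (simp add: sum_subtractf diff_divide_distrib)
    also have "\<bar>\<dots>\<bar> \<le> (\<Sum>t<m. \<bar>a t - L\<bar>) / real m"
      using m' by (simp add: abs_divide divide_right_mono sum_abs)
    also have "(\<Sum>t<m. \<bar>a t - L\<bar>) = B + (\<Sum>t\<in>{N..<m}. \<bar>a t - L\<bar>)"
      unfolding B_def using m' sum.atLeastLessThan_concat[of 0 N m "\<lambda>t. \<bar>a t - L\<bar>"]
      by (simp add: atLeast0LessThan)
    also have "(\<Sum>t\<in>{N..<m}. \<bar>a t - L\<bar>) \<le> (\<Sum>t\<in>{N..<m}. e / 2)"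
      using N by (intro sum_mono) (auto intro: less_imp_le)
    also have "\<dots> \<le> real m * (e / 2)" using e by (simp add: mult_right_mono)
    finally have "\<bar>(\<Sum>t<m. a t) / real m - L\<bar> \<le> (B + real m * (e / 2)) / real m"
      using m' by (simp add: divide_right_mono)
    also have "\<dots> < e" using m' e by (simp add: field_simps)
    finally show ?thesis by simp
  qed
  then show "\<exists>no. \<forall>m\<ge>no. norm ((\<Sum>t<m. a t) / real m - L) < e" by blast
qed

context prob_space
begin

text \<open>Each new summand adds its own square and twice its correlations with the earlier ones; a
  geometric series bounds these uniformly, so the growth is linear in \<open>m\<close>.\<close>

lemma second_moment_sum_le:
  assumes int: "\<And>s t. integrable M (\<lambda>\<omega>. u s \<omega> * u t \<omega> :: real)"
    and corr: "\<And>s k. expectation (\<lambda>\<omega>. u s \<omega> * u (s + k) \<omega>) \<le> C * r ^ k"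
    and r: "0 \<le> r" "r < 1" and C: "0 \<le> C"
  shows "expectation (\<lambda>\<omega>. (\<Sum>t<m. u t \<omega>)\<^sup>2) \<le> real m * (2 * C / (1 - r))"
proof (induction m)
  case (Suc m)
  have int_sum: "integrable M (\<lambda>\<omega>. (\<Sum>t<m. u t \<omega>)\<^sup>2)"
    unfolding power2_eq_square sum_product by (intro Bochner_Integration.integrable_sum int)
  have corr_m: "expectation (\<lambda>\<omega>. u s \<omega> * u m \<omega>) \<le> C * r ^ (m - s)" if "s \<le> m" for s
    using corr[of s "m - s"] that by simp
  have "(\<Sum>s<m. expectation (\<lambda>\<omega>. u s \<omega> * u m \<omega>)) + expectation (\<lambda>\<omega>. u m \<omega> * u m \<omega>)
      \<le> (\<Sum>s<m. C * r ^ (m - s)) + C * r ^ (m - m)"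
    by (intro add_mono sum_mono corr_m) auto
  also have "\<dots> = (\<Sum>s<Suc m. C * r ^ (m - s))" by simp
  also have "\<dots> = C * (\<Sum>k<Suc m. r ^ k)"
    using sum.nat_diff_reindex[of "\<lambda>k. r ^ k" "Suc m"]
    by (simp only: diff_Suc_Suc sum_distrib_left[symmetric])
  also have "\<dots> \<le> C * (1 / (1 - r))"
  proof (intro mult_left_mono C)
    have "(\<Sum>k<Suc m. r ^ k) = (1 - r ^ Suc m) / (1 - r)"
      using r by (subst sum_gp_strict) auto
    also have "\<dots> \<le> 1 / (1 - r)" using r by (intro divide_right_mono) auto
    finally show "(\<Sum>k<Suc m. r ^ k) \<le> 1 / (1 - r)" .
  qed
  finally have *: "(\<Sum>s<m. expectation (\<lambda>\<omega>. u s \<omega> * u m \<omega>)) + expectation (\<lambda>\<omega>. u m \<omega> * u m \<omega>)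
      \<le> C / (1 - r)" by simp
  \<comment> \<open>The own square occurs once in the expansion but is counted twice in the estimate
    below; its nonnegativity permits this.\<close>
  have "0 \<le> expectation (\<lambda>\<omega>. u m \<omega> * u m \<omega>)" by (rule Bochner_Integration.integral_nonneg) simp
  have "(\<Sum>t<Suc m. u t \<omega>)\<^sup>2 = (\<Sum>t<m. u t \<omega>)\<^sup>2 + 2 * (\<Sum>s<m. u s \<omega> * u m \<omega>) + u m \<omega> * u m \<omega>" for \<omega>
    by (simp add: power2_sum sum_distrib_right power2_eq_square algebra_simps sum_distrib_left)
  then have "expectation (\<lambda>\<omega>. (\<Sum>t<Suc m. u t \<omega>)\<^sup>2) = expectation (\<lambda>\<omega>. (\<Sum>t<m. u t \<omega>)\<^sup>2) +
      2 * (\<Sum>s<m. expectation (\<lambda>\<omega>. u s \<omega> * u m \<omega>)) + expectation (\<lambda>\<omega>. u m \<omega> * u m \<omega>)"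
    using int_sum int by simp
  also have "\<dots> \<le> real m * (2 * C / (1 - r)) + 2 * (C / (1 - r))"
    using Suc * \<open>0 \<le> expectation (\<lambda>\<omega>. u m \<omega> * u m \<omega>)\<close> by linarith
  finally show ?case by (simp add: algebra_simps add_divide_distrib)
qed simp

text \<open>The arithmetic-geometric mean inequality with a free parameter \<open>e\<close>, chosen
  later to balance the two terms.\<close>

lemma expectation_abs_le:
  fixes D :: "'a \<Rightarrow> real"
  assumes "D \<in> borel_measurable M" "integrable M (\<lambda>\<omega>. (D \<omega>)\<^sup>2)" "e > 0"
  shows "integrable M D" "expectation (\<lambda>\<omega>. \<bar>D \<omega>\<bar>) \<le> e / 2 + expectation (\<lambda>\<omega>. (D \<omega>)\<^sup>2) / (2 * e)"
proof -
  have le: "\<bar>D \<omega>\<bar> \<le> e / 2 + (D \<omega>)\<^sup>2 / (2 * e)" for \<omega>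
  proof -
    have "0 \<le> (\<bar>D \<omega>\<bar> - e)\<^sup>2" by simp
    then have "2 * e * \<bar>D \<omega>\<bar> \<le> e\<^sup>2 + (D \<omega>)\<^sup>2" by (simp add: power2_diff algebra_simps)
    then show ?thesis using assms(3) by (simp add: field_simps power2_eq_square)
  qed
  have int: "integrable M (\<lambda>\<omega>. e / 2 + (D \<omega>)\<^sup>2 / (2 * e))" using assms(2) by simp
  show D: "integrable M D"
    by (rule Bochner_Integration.integrable_bound[OF int assms(1)])
      (use le assms(3) in \<open>auto intro: order_trans\<close>)
  have "expectation (\<lambda>\<omega>. \<bar>D \<omega>\<bar>) \<le> expectation (\<lambda>\<omega>. e / 2 + (D \<omega>)\<^sup>2 / (2 * e))"
    using D int le by (intro integral_mono) auto
  also have "\<dots> = e / 2 + expectation (\<lambda>\<omega>. (D \<omega>)\<^sup>2) / (2 * e)" using assms(2) by (simp add: prob_space)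
  finally show "expectation (\<lambda>\<omega>. \<bar>D \<omega>\<bar>) \<le> e / 2 + expectation (\<lambda>\<omega>. (D \<omega>)\<^sup>2) / (2 * e)" .
qed

lemma converges_in_probI:
  assumes int: "\<And>n. integrable M (X n)"
    and lim: "(\<lambda>n. expectation (\<lambda>\<omega>. \<bar>X n \<omega> - c\<bar>)) \<longlonglongrightarrow> 0"
  shows "converges_in_prob X c"
  unfolding converges_in_prob_def
proof (intro conjI allI impI)
  show "random_variable borel (X n)" for n using int[of n] by auto
  fix e :: real assume e: "e > 0"
  have le: "prob {\<omega> \<in> space M. \<bar>X n \<omega> - c\<bar> > e} \<le> expectation (\<lambda>\<omega>. \<bar>X n \<omega> - c\<bar>) / e" for n
  proof -
    have [measurable]: "X n \<in> borel_measurable M" using int[of n] by auto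
    have "prob {\<omega> \<in> space M. \<bar>X n \<omega> - c\<bar> > e} \<le> prob {\<omega> \<in> space M. \<bar>X n \<omega> - c\<bar> \<ge> e}"
      by (intro finite_measure_mono) auto
    also have "\<dots> \<le> expectation (\<lambda>\<omega>. \<bar>X n \<omega> - c\<bar>) / e"
      using e int[of n] by (intro integral_Markov_inequality_measure[where A = "{}"]) auto
    finally show ?thesis .
  qed
  have "(\<lambda>n. expectation (\<lambda>\<omega>. \<bar>X n \<omega> - c\<bar>) / e) \<longlonglongrightarrow> 0 / e"
    using e by (intro tendsto_divide lim) auto
  then have lim': "(\<lambda>n. expectation (\<lambda>\<omega>. \<bar>X n \<omega> - c\<bar>) / e) \<longlonglongrightarrow> 0" by simp
  show "(\<lambda>n. prob {\<omega> \<in> space M. \<bar>X n \<omega> - c\<bar> > e}) \<longlonglongrightarrow> 0"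
    by (rule tendsto_sandwich[OF _ _ tendsto_const lim']) (simp_all add: le)
qed

end

text \<open>The error has three parts: the fluctuation of the centred squares, of order m^(-1/2) in
  L1; the Cesaro error of the variances; and the contribution of the nonzero means, again a Cesaro
  mean tending to 0.\<close>

lemma (in gaussian_family) square_average_converges:
  fixes X :: "nat \<Rightarrow> 'a \<Rightarrow> real"
  assumes X: "\<And>t. X t \<in> gspan"
    and mean: "(\<lambda>t. expectation (X t)) \<longlonglongrightarrow> 0"
    and var: "(\<lambda>t. covar (X t) (X t)) \<longlonglongrightarrow> V"
    and cov: "\<And>s k. \<bar>covar (X s) (X (s + k))\<bar> \<le> C * \<rho> ^ k"
    and \<rho>: "0 \<le> \<rho>" "\<rho> < 1"
  shows "integrable M (\<lambda>\<omega>. (X t \<omega>)\<^sup>2)"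
    and "(\<lambda>m. expectation (\<lambda>\<omega>. \<bar>(\<Sum>t<m. (X t \<omega>)\<^sup>2) / real m - V\<bar>)) \<longlonglongrightarrow> 0"
proof -
  define \<mu> where "\<mu> t = expectation (X t)" for t
  define x where "x t \<omega> = X t \<omega> - \<mu> t" for t \<omega>
  define v where "v t = covar (X t) (X t)" for t
  have meas [measurable]: "x t \<in> borel_measurable M" for t
    using gspan_measurable[OF X[of t]] by (simp add: x_def[abs_def])
  have int_x: "integrable M (x t)" and int_x2: "integrable M (\<lambda>\<omega>. (x t \<omega>)\<^sup>2)" for t
    using gspan_moments(2)[OF X[of t], of 1] gspan_moments(2)[OF X[of t], of 2]
    by (simp_all add: x_def[abs_def] \<mu>_def)
  have E_x2: "expectation (\<lambda>\<omega>. (x t \<omega>)\<^sup>2) = v t" for t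
    by (simp add: v_def covar_def x_def \<mu>_def power2_eq_square)
  have int_x4: "integrable M (\<lambda>\<omega>. (x s \<omega>)\<^sup>2 * (x t \<omega>)\<^sup>2)"
    and E_x4: "expectation (\<lambda>\<omega>. (x s \<omega>)\<^sup>2 * (x t \<omega>)\<^sup>2) = v s * v t + 2 * (covar (X s) (X t))\<^sup>2" for s t
    using gspan_centered_squares_integrable[OF X X, of s t] gspan_centered_squares[OF X X, of s t]
    by (simp_all add: x_def \<mu>_def v_def)
  have X_sq: "(X t \<omega>)\<^sup>2 = (x t \<omega>)\<^sup>2 + (2 * \<mu> t * x t \<omega> + (\<mu> t)\<^sup>2)" for t \<omega>
    by (simp add: x_def power2_eq_square algebra_simps)
  show int_X2: "integrable M (\<lambda>\<omega>. (X t \<omega>)\<^sup>2)" for t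
    unfolding X_sq using int_x int_x2 by simp
  define u where "u t \<omega> = (x t \<omega>)\<^sup>2 - v t" for t \<omega>
  have uu: "u s \<omega> * u t \<omega> = (x s \<omega>)\<^sup>2 * (x t \<omega>)\<^sup>2 - v t * (x s \<omega>)\<^sup>2 - v s * (x t \<omega>)\<^sup>2 + v s * v t" for s t \<omega>
    by (simp add: u_def algebra_simps)
  have int_uu: "integrable M (\<lambda>\<omega>. u s \<omega> * u t \<omega>)" for s t
    unfolding uu using int_x4 int_x2 by simp
  have E_uu: "expectation (\<lambda>\<omega>. u s \<omega> * u t \<omega>) = 2 * (covar (X s) (X t))\<^sup>2" for s t
    unfolding uu using int_x4[of s t] int_x2[of s] int_x2[of t] by (simp add: E_x4 E_x2 prob_space)
  \<comment> \<open>Correlations of squares are squared covariances, so they decay at the rate of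
    \<rho> squared.\<close>
  have "expectation (\<lambda>\<omega>. u s \<omega> * u (s + k) \<omega>) \<le> 2 * C\<^sup>2 * (\<rho>\<^sup>2) ^ k" for s k
  proof -
    have "\<bar>covar (X s) (X (s + k))\<bar>\<^sup>2 \<le> (C * \<rho> ^ k)\<^sup>2" by (intro power_mono cov) auto
    then show ?thesis by (simp add: E_uu power_mult_distrib mult.commute flip: power_mult)
  qed
  from second_moment_sum_le[OF int_uu this]
  have second: "expectation (\<lambda>\<omega>. (\<Sum>t<m. u t \<omega>)\<^sup>2) \<le> real m * (2 * (2 * C\<^sup>2) / (1 - \<rho>\<^sup>2))" for m
    using \<rho> by (simp add: power_less_one_iff)
  define K where "K = 2 * (2 * C\<^sup>2) / (1 - \<rho>\<^sup>2)"
  define D where "D m \<omega> = (\<Sum>t<m. u t \<omega>) / real m" for m \<omega>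
  have meas_D: "D m \<in> borel_measurable M" for m
    unfolding D_def[abs_def] u_def[abs_def] by measurable
  have int_D2: "integrable M (\<lambda>\<omega>. (D m \<omega>)\<^sup>2)" for m
    unfolding D_def power_divide unfolding power2_eq_square sum_product
    by (intro integrable_divide Bochner_Integration.integrable_sum int_uu)
  have int_D: "integrable M (D m)" for m
    using expectation_abs_le(1)[OF meas_D int_D2, of 1] by simp
  have E_D: "expectation (\<lambda>\<omega>. \<bar>D m \<omega>\<bar>) \<le> (1 + K) / 2 * (1 / sqrt (real m))" if m: "m > 0" for m
  proof -
    have "expectation (\<lambda>\<omega>. (D m \<omega>)\<^sup>2) = expectation (\<lambda>\<omega>. (\<Sum>t<m. u t \<omega>)\<^sup>2) / (real m)\<^sup>2"
      by (simp add: D_def power_divide)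
    also have "\<dots> \<le> (real m * K) / (real m)\<^sup>2"
      using second[of m] by (intro divide_right_mono) (auto simp: K_def)
    also have "\<dots> = K / real m" using m by (simp add: power2_eq_square)
    finally have E2: "expectation (\<lambda>\<omega>. (D m \<omega>)\<^sup>2) \<le> K / real m" .
    \<comment> \<open>With second moment at most \<open>K / real m\<close>, this choice makes both
      terms of \<open>expectation_abs_le\<close> of order \<open>e\<close>.\<close>
    define e where "e = 1 / sqrt (real m)"
    have e: "e > 0" "1 / real m = e * e" using m by (auto simp: e_def)
    have "expectation (\<lambda>\<omega>. \<bar>D m \<omega>\<bar>) \<le> e / 2 + expectation (\<lambda>\<omega>. (D m \<omega>)\<^sup>2) / (2 * e)"
      by (rule expectation_abs_le(2)[OF meas_D int_D2 e(1)])
    also have "\<dots> \<le> e / 2 + (K * (e * e)) / (2 * e)"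
      using E2 e by (intro add_left_mono divide_right_mono) (auto simp flip: e(2))
    also have "\<dots> = (1 + K) / 2 * e" using e(1) by (simp add: field_simps)
    finally show ?thesis by (simp add: e_def)
  qed
  \<comment> \<open>Comes from \<open>2 * \<bar>\<mu> t\<bar>\<close> times the bound (1 + v t)/2
    for the mean of \<open>\<bar>x t\<bar>\<close>, plus the squared mean.\<close>
  define \<beta> where "\<beta> t = \<bar>\<mu> t\<bar> * (1 + v t) + (\<mu> t)\<^sup>2" for t
  have lim_\<beta>: "\<beta> \<longlonglongrightarrow> 0"
  proof -
    have "\<beta> \<longlonglongrightarrow> \<bar>0\<bar> * (1 + V) + 0\<^sup>2"
      unfolding \<beta>_def[abs_def] using mean var
      by (intro tendsto_intros) (simp_all add: \<mu>_def[abs_def] v_def[abs_def])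
    then show ?thesis by simp
  qed
  have E_rest: "expectation (\<lambda>\<omega>. \<bar>2 * \<mu> t * x t \<omega> + (\<mu> t)\<^sup>2\<bar>) \<le> \<beta> t" for t
  proof -
    have 1: "expectation (\<lambda>\<omega>. \<bar>x t \<omega>\<bar>) \<le> 1 / 2 + v t / 2"
      using expectation_abs_le(2)[OF meas int_x2, of 1 t] by (simp add: E_x2)
    have "expectation (\<lambda>\<omega>. \<bar>2 * \<mu> t * x t \<omega> + (\<mu> t)\<^sup>2\<bar>) \<le>
        expectation (\<lambda>\<omega>. 2 * \<bar>\<mu> t\<bar> * \<bar>x t \<omega>\<bar> + (\<mu> t)\<^sup>2)"
      using int_x by (intro integral_mono) (auto intro: order_trans[OF abs_triangle_ineq] simp: abs_mult)
    also have "\<dots> = 2 * \<bar>\<mu> t\<bar> * expectation (\<lambda>\<omega>. \<bar>x t \<omega>\<bar>) + (\<mu> t)\<^sup>2"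
      using int_x by (simp add: prob_space)
    also have "\<dots> \<le> 2 * \<bar>\<mu> t\<bar> * (1 / 2 + v t / 2) + (\<mu> t)\<^sup>2"
      by (intro add_right_mono mult_left_mono 1) auto
    also have "\<dots> = \<beta> t" by (simp add: \<beta>_def algebra_simps)
    finally show ?thesis .
  qed
  have bound: "expectation (\<lambda>\<omega>. \<bar>(\<Sum>t<m. (X t \<omega>)\<^sup>2) / real m - V\<bar>) \<le>
      (1 + K) / 2 * (1 / sqrt (real m)) + \<bar>(\<Sum>t<m. v t) / real m - V\<bar> + (\<Sum>t<m. \<beta> t) / real m"
    if m: "m > 0" for m
  proof -
    define b where "b = \<bar>(\<Sum>t<m. v t) / real m - V\<bar>"
    define R where "R \<omega> = (\<Sum>t<m. \<bar>2 * \<mu> t * x t \<omega> + (\<mu> t)\<^sup>2\<bar>) / real m" for \<omega>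
    have int_R: "integrable M R"
      unfolding R_def[abs_def] using int_x by (intro integrable_divide Bochner_Integration.integrable_sum) auto
    have pointwise: "\<bar>(\<Sum>t<m. (X t \<omega>)\<^sup>2) / real m - V\<bar> \<le> \<bar>D m \<omega>\<bar> + b + R \<omega>" for \<omega>
    proof -
      have "(\<Sum>t<m. (X t \<omega>)\<^sup>2) = (\<Sum>t<m. u t \<omega>) + (\<Sum>t<m. v t) + (\<Sum>t<m. 2 * \<mu> t * x t \<omega> + (\<mu> t)\<^sup>2)"
        by (simp add: X_sq u_def flip: sum.distrib)
      then have "(\<Sum>t<m. (X t \<omega>)\<^sup>2) / real m - V = D m \<omega> + ((\<Sum>t<m. v t) / real m - V) +
          (\<Sum>t<m. 2 * \<mu> t * x t \<omega> + (\<mu> t)\<^sup>2) / real m"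
        by (simp add: D_def add_divide_distrib)
      moreover have "\<bar>(\<Sum>t<m. 2 * \<mu> t * x t \<omega> + (\<mu> t)\<^sup>2) / real m\<bar> \<le> R \<omega>"
        using m unfolding R_def abs_divide by (intro divide_mono sum_abs) auto
      ultimately show ?thesis unfolding b_def by linarith
    qed
    have "expectation (\<lambda>\<omega>. \<bar>(\<Sum>t<m. (X t \<omega>)\<^sup>2) / real m - V\<bar>) \<le>
        expectation (\<lambda>\<omega>. \<bar>D m \<omega>\<bar> + b + R \<omega>)"
      using int_X2 int_D int_R pointwise by (intro integral_mono) auto
    also have "\<dots> = expectation (\<lambda>\<omega>. \<bar>D m \<omega>\<bar>) + b + expectation R"
      using int_D int_R by (simp add: prob_space)
    also have "expectation R = (\<Sum>t<m. expectation (\<lambda>\<omega>. \<bar>2 * \<mu> t * x t \<omega> + (\<mu> t)\<^sup>2\<bar>)) / real m"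
      unfolding R_def[abs_def] using int_x by simp
    also have "\<dots> \<le> (\<Sum>t<m. \<beta> t) / real m"
      by (intro divide_right_mono sum_mono E_rest) auto
    finally show ?thesis using E_D[OF m] by (simp add: b_def)
  qed
  have lim: "(\<lambda>m. (1 + K) / 2 * (1 / sqrt (real m)) + \<bar>(\<Sum>t<m. v t) / real m - V\<bar> + (\<Sum>t<m. \<beta> t) / real m)
    \<longlonglongrightarrow> (1 + K) / 2 * 0 + \<bar>V - V\<bar> + 0"
  proof (intro tendsto_add tendsto_mult tendsto_const tendsto_rabs tendsto_diff)
    show "(\<lambda>m. 1 / sqrt (real m)) \<longlonglongrightarrow> 0"
      by (intro tendsto_divide_0[OF tendsto_const] filterlim_at_top_imp_at_infinity
          filterlim_compose[OF sqrt_at_top filterlim_real_sequentially])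
    show "(\<lambda>m. (\<Sum>t<m. v t) / real m) \<longlonglongrightarrow> V"
      by (rule cesaro_mean) (use var in \<open>simp add: v_def[abs_def]\<close>)
    show "(\<lambda>m. (\<Sum>t<m. \<beta> t) / real m) \<longlonglongrightarrow> 0" by (rule cesaro_mean[OF lim_\<beta>])
  qed
  then have lim': "(\<lambda>m. (1 + K) / 2 * (1 / sqrt (real m)) + \<bar>(\<Sum>t<m. v t) / real m - V\<bar> +
      (\<Sum>t<m. \<beta> t) / real m) \<longlonglongrightarrow> 0" by simp
  show "(\<lambda>m. expectation (\<lambda>\<omega>. \<bar>(\<Sum>t<m. (X t \<omega>)\<^sup>2) / real m - V\<bar>)) \<longlonglongrightarrow> 0"
  proof (rule tendsto_sandwich[OF _ _ tendsto_const lim'])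
    show "\<forall>\<^sub>F m in sequentially. 0 \<le> expectation (\<lambda>\<omega>. \<bar>(\<Sum>t<m. (X t \<omega>)\<^sup>2) / real m - V\<bar>)"
      by (intro always_eventually allI Bochner_Integration.integral_nonneg) simp
    show "\<forall>\<^sub>F m in sequentially. expectation (\<lambda>\<omega>. \<bar>(\<Sum>t<m. (X t \<omega>)\<^sup>2) / real m - V\<bar>) \<le>
      (1 + K) / 2 * (1 / sqrt (real m)) + \<bar>(\<Sum>t<m. v t) / real m - V\<bar> + (\<Sum>t<m. \<beta> t) / real m"
      using eventually_gt_at_top[of 0] by eventually_elim (rule bound)
  qed
qed

context gaussian_family
begin

text \<open>Polarization: the product of two components is a quarter of the difference of the
  squares of their sum and difference, both scalar Gaussian sequences.\<close>

lemma product_average_converges: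
  fixes v :: "nat \<Rightarrow> 'a \<Rightarrow> real^'d"
  assumes v: "\<And>t. gvec (v t)"
    and mean: "(\<lambda>t. mean_vec (v t)) \<longlonglongrightarrow> 0"
    and var: "(\<lambda>t. cross_cov (v t) (v t)) \<longlonglongrightarrow> V"
    and cov: "\<And>s k. norm (cross_cov (v (s + k)) (v s)) \<le> C * \<rho> ^ k"
    and \<rho>: "0 \<le> \<rho>" "\<rho> < 1"
  shows "integrable M (\<lambda>\<omega>. v t \<omega> $ i * v t \<omega> $ j)"
    and "(\<lambda>m. expectation (\<lambda>\<omega>. \<bar>(\<Sum>t<m. v t \<omega> $ i * v t \<omega> $ j) / real m - V $ i $ j\<bar>)) \<longlonglongrightarrow> 0"
proof -
  let ?c = "\<lambda>s t i j. covar (\<lambda>\<omega>. v s \<omega> $ i) (\<lambda>\<omega>. v t \<omega> $ j)"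
  define X where "X b t \<omega> = v t \<omega> $ i + b * v t \<omega> $ j" for b :: real and t \<omega>
  have G: "X b t \<in> gspan" for b t
    unfolding X_def[abs_def] by (intro gspan_add gspan_scale gvec_nth v)
  have covX: "covar (X b s) (X b t) = ?c s t i i + b * ?c s t i j + b * (?c s t j i + b * ?c s t j j)" for b s t
  proof -
    have *: "covar U (X b t) = covar U (\<lambda>\<omega>. v t \<omega> $ i) + b * covar U (\<lambda>\<omega>. v t \<omega> $ j)"
      if "U \<in> gspan" for U
      unfolding covar_commute[of U] unfolding X_def[abs_def]
      by (subst covar_add_left) (simp_all add: covar_scale_left gspan_scale gvec_nth v that)
    have "covar (X b s) (X b t) = covar (\<lambda>\<omega>. v s \<omega> $ i) (X b t) + b * covar (\<lambda>\<omega>. v s \<omega> $ j) (X b t)"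
      by (subst X_def[abs_def], subst covar_add_left)
        (simp_all add: covar_scale_left gspan_scale gvec_nth v G)
    then show ?thesis by (simp add: * gvec_nth v)
  qed
  have meanX: "(\<lambda>t. expectation (X b t)) \<longlonglongrightarrow> 0" for b
  proof -
    have "expectation (X b t) = mean_vec (v t) $ i + b * mean_vec (v t) $ j" for t
      unfolding X_def[abs_def] by (simp add: mean_vec_def gspan_moments(1) gvec_nth v)
    moreover have "(\<lambda>t. mean_vec (v t) $ i + b * mean_vec (v t) $ j) \<longlonglongrightarrow> (0::real^'d) $ i + b * (0::real^'d) $ j"
      by (intro tendsto_intros mean)
    ultimately show ?thesis by simp
  qed
  define L where "L b = V $ i $ i + b * V $ i $ j + b * (V $ j $ i + b * V $ j $ j)" for b
  have varX: "(\<lambda>t. covar (X b t) (X b t)) \<longlonglongrightarrow> L b" for b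
    unfolding covX L_def cross_cov_nth[symmetric] by (intro tendsto_intros var)
  \<comment> \<open>In the hypothesis the later time stands first, so the transposed entry is
    read.\<close>
  have entry: "\<bar>?c s (s + k) i j\<bar> \<le> C * \<rho> ^ k" for s k i j
    using order_trans[OF abs_entry_le_norm cov, of "s" k j i]
    by (simp add: cross_cov_nth covar_commute)
  have corrX: "\<bar>covar (X b s) (X b (s + k))\<bar> \<le> (4 * C) * \<rho> ^ k" if "b = 1 \<or> b = - 1" for b s k
    unfolding covX using that entry[of s i k i] entry[of s i k j]
      entry[of s j k i] entry[of s j k j] by auto
  note sq = square_average_converges[OF G meanX varX corrX \<rho>]
  have polar: "v t \<omega> $ i * v t \<omega> $ j = ((X 1 t \<omega>)\<^sup>2 - (X (- 1) t \<omega>)\<^sup>2) / 4" for t \<omega>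
    by (simp add: X_def power2_eq_square algebra_simps)
  show int: "integrable M (\<lambda>\<omega>. v t \<omega> $ i * v t \<omega> $ j)" for t
    unfolding polar using sq(1) by simp
  \<comment> \<open>Symmetry of the limit is needed because \<open>L 1 - L (- 1)\<close> is twice
    the sum of the two mirrored entries.\<close>
  have "(\<lambda>t. cross_cov (v t) (v t) $ i $ j - cross_cov (v t) (v t) $ j $ i) \<longlonglongrightarrow> V $ i $ j - V $ j $ i"
    by (intro tendsto_intros var)
  then have sym: "V $ j $ i = V $ i $ j"
    by (simp add: cross_cov_nth covar_commute LIMSEQ_const_iff)
  define A where "A b m \<omega> = (\<Sum>t<m. (X b t \<omega>)\<^sup>2) / real m - L b" for b m \<omega>
  have int_A: "integrable M (A b m)" if "b = 1 \<or> b = - 1" for b m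
    unfolding A_def[abs_def] using sq(1)[OF that] by simp
  have split: "(\<Sum>t<m. v t \<omega> $ i * v t \<omega> $ j) / real m - V $ i $ j = (A 1 m \<omega> - A (- 1) m \<omega>) / 4" for m \<omega>
    by (simp add: polar A_def L_def sym sum_subtractf diff_divide_distrib flip: sum_divide_distrib)
  have bound: "expectation (\<lambda>\<omega>. \<bar>(\<Sum>t<m. v t \<omega> $ i * v t \<omega> $ j) / real m - V $ i $ j\<bar>) \<le>
      (expectation (\<lambda>\<omega>. \<bar>A 1 m \<omega>\<bar>) + expectation (\<lambda>\<omega>. \<bar>A (- 1) m \<omega>\<bar>)) / 4" for m
  proof -
    have "expectation (\<lambda>\<omega>. \<bar>(A 1 m \<omega> - A (- 1) m \<omega>) / 4\<bar>) \<le> expectation (\<lambda>\<omega>. (\<bar>A 1 m \<omega>\<bar> + \<bar>A (- 1) m \<omega>\<bar>) / 4)"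
      using int_A by (intro integral_mono) auto
    then show ?thesis unfolding split using int_A by simp
  qed
  have "(\<lambda>m. (expectation (\<lambda>\<omega>. \<bar>A 1 m \<omega>\<bar>) + expectation (\<lambda>\<omega>. \<bar>A (- 1) m \<omega>\<bar>)) / 4) \<longlonglongrightarrow> (0 + 0) / 4"
    unfolding A_def by (intro tendsto_intros sq(2)) auto
  then have lim: "(\<lambda>m. (expectation (\<lambda>\<omega>. \<bar>A 1 m \<omega>\<bar>) + expectation (\<lambda>\<omega>. \<bar>A (- 1) m \<omega>\<bar>)) / 4) \<longlonglongrightarrow> 0"
    by simp
  show "(\<lambda>m. expectation (\<lambda>\<omega>. \<bar>(\<Sum>t<m. v t \<omega> $ i * v t \<omega> $ j) / real m - V $ i $ j\<bar>)) \<longlonglongrightarrow> 0"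
    by (rule tendsto_sandwich[OF _ _ tendsto_const lim])
      (intro always_eventually allI bound Bochner_Integration.integral_nonneg abs_ge_zero)+
qed

end

subsection \<open>The prediction error\<close>

context riccati_sequence
begin

section \<open>Limits in the time-varying covariance recursion\<close>

lemma closed_loop_convergent: "\<exists>A. (\<lambda>t. closed_loop (P t)) \<longlonglongrightarrow> A"
proof -
  obtain K where "(\<lambda>t. gain (P t)) \<longlonglongrightarrow> K" using gain_convergent by blast
  then have "(\<lambda>t. closed_loop (P t)) \<longlonglongrightarrow> T ** (mat 1 - K ** Z)"
    unfolding closed_loop_def filt_def by (intro tendsto_intros)
  then show ?thesis by (rule exI)
qed

lemma trans_mat_convergent: "\<exists>G. (\<lambda>s. trans_mat s k) \<longlonglongrightarrow> G"
proof (induction k)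
  case 0
  have "(\<lambda>s. trans_mat s 0) \<longlonglongrightarrow> mat 1" by simp
  then show ?case by (rule exI)
next
  case (Suc k)
  then obtain G where G: "(\<lambda>s. trans_mat s k) \<longlonglongrightarrow> G" by blast
  obtain A where A: "(\<lambda>t. closed_loop (P t)) \<longlonglongrightarrow> A" using closed_loop_convergent by blast
  have "(\<lambda>s. trans_mat s (Suc k)) \<longlonglongrightarrow> A ** G"
    unfolding trans_mat.simps by (intro tendsto_intros G LIMSEQ_ignore_initial_segment[OF A])
  then show ?case by (rule exI)
qed

lemma trans_mat_tendsto_0: "(\<lambda>k. trans_mat s k) \<longlonglongrightarrow> 0"
proof -
  obtain C \<rho> where C: "0 < \<rho>" "\<rho> < 1" "0 < C" "\<And>s k. norm (trans_mat s k) \<le> C * \<rho> ^ k"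
    using trans_mat_bound by metis
  have "(\<lambda>k. C * \<rho> ^ k) \<longlonglongrightarrow> C * 0"
    using C by (intro tendsto_intros LIMSEQ_realpow_zero) auto
  then have "(\<lambda>k. C * \<rho> ^ k) \<longlonglongrightarrow> 0" by simp
  then show ?thesis by (rule Lim_null_comparison[rotated]) (simp add: C(4))
qed

text \<open>Unrolled, \<open>X t\<close> is a sum over past inputs, each between two transition
  matrices. Ordered by the age \<open>k\<close> of the input, every term converges as t grows and is
  dominated by a geometric series, so Tannery's theorem applies.\<close>

lemma covariance_convergent:
  assumes X_Suc: "\<And>t. X (Suc t) = closed_loop (P t) ** X t ** transpose (closed_loop (P t)) + V t"
    and V: "V \<longlonglongrightarrow> V\<^sub>0"
  shows "\<exists>L. X \<longlonglongrightarrow> L"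
proof -
  obtain C \<rho> where C: "0 < \<rho>" "\<rho> < 1" "0 < C" "\<And>s k. norm (trans_mat s k) \<le> C * \<rho> ^ k"
    using trans_mat_bound by metis
  have "Bseq V" using V convergentI convergent_imp_Bseq by blast
  then obtain B where B: "B > 0" "\<And>t. norm (V t) \<le> B" unfolding Bseq_def by blast
  \<comment> \<open>The contribution of input \<open>V s\<close> at time \<open>t\<close>; it enters
    at time \<open>Suc s\<close>, hence the shift.\<close>
  define g where "g t s = trans_mat (Suc s) (t - Suc s) ** V s ** transpose (trans_mat (Suc s) (t - Suc s))" for t s
  have X: "X t = trans_mat 0 t ** X 0 ** transpose (trans_mat 0 t) + (\<Sum>s<t. g t s)" for t
  proof (induction t)
    case (Suc t)
    let ?A = "closed_loop (P t)"
    have "g (Suc t) s = ?A ** g t s ** transpose ?A" if "s < t" for s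
    proof -
      have "trans_mat (Suc s) (t - s) = ?A ** trans_mat (Suc s) (t - Suc s)"
        using that trans_mat.simps(2)[of "Suc s" "t - Suc s"] by (simp add: Suc_diff_Suc)
      then show ?thesis by (simp add: g_def matrix_transpose_mul matrix_mul_assoc)
    qed
    then have "(\<Sum>s<Suc t. g (Suc t) s) = (\<Sum>s<t. ?A ** g t s ** transpose ?A) + V t"
      by (simp add: g_def)
    also have "(\<Sum>s<t. ?A ** g t s ** transpose ?A) = ?A ** (\<Sum>s<t. g t s) ** transpose ?A"
      unfolding bounded_bilinear.sum_right[OF bounded_bilinear_matrix_mult]
        bounded_bilinear.sum_left[OF bounded_bilinear_matrix_mult] ..
    finally show ?case
      by (simp add: X_Suc Suc.IH matrix_transpose_mul matrix_mul_assoc matrix_mult_add_left matrix_mult_add_right)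
  qed simp
  have lim1: "(\<lambda>t. trans_mat 0 t ** X 0 ** transpose (trans_mat 0 t)) \<longlonglongrightarrow> 0 ** X 0 ** transpose 0"
    by (intro tendsto_intros trans_mat_tendsto_0)
  define h where "h k t = trans_mat (Suc t) k ** V t ** transpose (trans_mat (Suc t) k)" for k t
  have reindex: "(\<Sum>s<t. g t s) = (\<Sum>k<t. h k (t - Suc k))" for t
  proof -
    have "(\<Sum>s<t. g t s) = (\<Sum>k<t. g t (t - Suc k))" by (rule sum.nat_diff_reindex[symmetric])
    also have "\<dots> = (\<Sum>k<t. h k (t - Suc k))"
      by (intro sum.cong) (auto simp: g_def h_def Suc_diff_Suc)
    finally show ?thesis .
  qed
  have "\<exists>H. (\<lambda>t. h k t) \<longlonglongrightarrow> H" for k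
  proof -
    obtain G where "(\<lambda>s. trans_mat s k) \<longlonglongrightarrow> G" using trans_mat_convergent by blast
    from LIMSEQ_Suc[OF this] have "(\<lambda>t. h k t) \<longlonglongrightarrow> G ** V\<^sub>0 ** transpose G"
      unfolding h_def by (intro tendsto_intros V)
    then show ?thesis by (rule exI)
  qed
  then obtain H where H: "\<And>k. (\<lambda>t. h k t) \<longlonglongrightarrow> H k" by metis
  have h_bound: "norm (h k t) \<le> C\<^sup>2 * B * (\<rho>\<^sup>2) ^ k" for k t
  proof -
    have "norm (h k t) \<le> norm (trans_mat (Suc t) k) * norm (V t) * norm (trans_mat (Suc t) k)"
      using norm_matrix_mult3_le[of "trans_mat (Suc t) k" "V t" "transpose (trans_mat (Suc t) k)"]
      by (simp add: h_def norm_transpose)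
    also have "\<dots> \<le> (C * \<rho> ^ k) * B * (C * \<rho> ^ k)"
      using C B by (intro mult_mono C(4) B(2)) auto
    also have "\<dots> = C\<^sup>2 * B * (\<rho>\<^sup>2) ^ k"
      by (simp add: power2_eq_square power_mult_distrib)
    finally show ?thesis .
  qed
  have "(\<lambda>t. (\<Sum>s<t. g t s) $ i $ j) \<longlonglongrightarrow> (\<Sum>k. H k $ i $ j)" for i j
  proof -
    \<comment> \<open>Padding with 0 beyond age \<open>t\<close> turns the growing finite sum into a
      series with a fixed index set.\<close>
    define a where "a k t = (if k < t then h k (t - Suc k) $ i $ j else 0)" for k t
    have a_lim: "(\<lambda>t. a k t) \<longlonglongrightarrow> H k $ i $ j" for k
    proof (rule LIMSEQ_offset[where k = "Suc k"])
      show "(\<lambda>t. a k (t + Suc k)) \<longlonglongrightarrow> H k $ i $ j"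
        unfolding a_def using tendsto_vec_nth[OF tendsto_vec_nth[OF H[of k], of i], of j] by simp
    qed
    have a_bound: "norm (a k t) \<le> C\<^sup>2 * B * (\<rho>\<^sup>2) ^ k" for k t
      using order_trans[OF abs_entry_le_norm h_bound] B(1) by (auto simp: a_def)
    have summ: "summable (\<lambda>k. C\<^sup>2 * B * (\<rho>\<^sup>2) ^ k)"
      using C by (intro summable_mult summable_geometric) (simp add: power_less_one_iff)
    have ev: "\<forall>\<^sub>F (k, t) in at_top \<times>\<^sub>F sequentially. norm (a k t) \<le> C\<^sup>2 * B * (\<rho>\<^sup>2) ^ k"
      using a_bound by (intro always_eventually) auto
    have "(\<lambda>t. \<Sum>k. a k t) \<longlonglongrightarrow> (\<Sum>k. H k $ i $ j)"
      using tannerys_theorem[OF a_lim ev summ trivial_limit_sequentially] by blast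
    moreover have "(\<Sum>k. a k t) = (\<Sum>s<t. g t s) $ i $ j" for t
    proof -
      have "(\<Sum>k. a k t) = (\<Sum>k<t. a k t)" by (rule suminf_finite) (auto simp: a_def)
      then show ?thesis unfolding reindex by (simp add: a_def)
    qed
    ultimately show ?thesis by simp
  qed
  then have "(\<lambda>t. \<Sum>s<t. g t s) \<longlonglongrightarrow> (\<chi> i j. \<Sum>k. H k $ i $ j)"
    by (intro tendsto_matrixI) simp
  from tendsto_add[OF lim1 this] show ?thesis
    unfolding X[symmetric] by (rule exI)
qed

end

text \<open>\<open>V\<^sub>\<epsilon>\<close> and \<open>V\<^sub>\<eta>\<close> are the true noise
  covariances and may differ from \<open>S\<close> and \<open>W\<close>, which determine the gain.
  Time starts at 0.\<close>

locale prediction_error = riccati_sequence Z T S W P n + gaussian_family M Sp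
  for Z :: "real^'p^'d" and T :: "real^'p^'p" and S :: "real^'d^'d" and W :: "real^'p^'p"
    and P :: "nat \<Rightarrow> real^'p^'p" and n :: nat and M :: "'a measure" and Sp :: "('a \<Rightarrow> real) set" +
  fixes e eta :: "nat \<Rightarrow> 'a \<Rightarrow> real^'p" and eps v :: "nat \<Rightarrow> 'a \<Rightarrow> real^'d"
    and V\<^sub>\<epsilon> :: "real^'d^'d" and V\<^sub>\<eta> :: "real^'p^'p"
  assumes gvec_e0: "gvec (e 0)" and gvec_eta: "gvec (eta t)" and gvec_eps: "gvec (eps t)"
    and mean_eta: "mean_vec (eta t) = 0" and mean_eps: "mean_vec (eps t) = 0"
    and cov_eta: "cross_cov (eta t) (eta t) = V\<^sub>\<eta>" and cov_eps: "cross_cov (eps t) (eps t) = V\<^sub>\<epsilon>"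
    and e0_eta: "cross_cov (e 0) (eta t) = 0" and e0_eps: "cross_cov (e 0) (eps t) = 0"
    and eta_eta: "s \<noteq> t \<Longrightarrow> cross_cov (eta s) (eta t) = 0"
    and eps_eps: "s \<noteq> t \<Longrightarrow> cross_cov (eps s) (eps t) = 0"
    and eps_eta: "cross_cov (eps s) (eta t) = 0"
    and e_Suc: "\<omega> \<in> space M \<Longrightarrow> e (Suc t) \<omega> =
      closed_loop (P t) *v e t \<omega> + (eta t \<omega> - (T ** gain (P t)) *v eps t \<omega>)"
    and v: "\<omega> \<in> space M \<Longrightarrow> v t \<omega> = Z *v e t \<omega> + eps t \<omega>"
begin

definition noise :: "nat \<Rightarrow> 'a \<Rightarrow> real^'p" where
  "noise t \<omega> = eta t \<omega> - (T ** gain (P t)) *v eps t \<omega>"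

lemma gvec_noise: "gvec (noise t)"
  unfolding noise_def[abs_def] by (intro gvec_diff gvec_mult gvec_eta gvec_eps)

lemma gvec_e: "gvec (e t)"
proof (induction t)
  case (Suc t)
  have "gvec (\<lambda>\<omega>. closed_loop (P t) *v e t \<omega> + noise t \<omega>)"
    by (intro gvec_add gvec_mult Suc gvec_noise)
  then show ?case by (rule gvec_cong) (simp add: e_Suc noise_def)
qed (rule gvec_e0)

lemma gvec_v: "gvec (v t)"
proof -
  have "gvec (\<lambda>\<omega>. Z *v e t \<omega> + eps t \<omega>)" by (intro gvec_add gvec_mult gvec_e gvec_eps)
  then show ?thesis by (rule gvec_cong) (simp add: v)
qed

lemma cross_cov_e_Suc:
  "gvec U \<Longrightarrow> cross_cov (e (Suc t)) U = closed_loop (P t) ** cross_cov (e t) U + cross_cov (noise t) U"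
  using cross_cov_cong[of "e (Suc t)" "\<lambda>\<omega>. closed_loop (P t) *v e t \<omega> + noise t \<omega>" U U]
  by (simp add: e_Suc noise_def[symmetric] cross_cov_add_left cross_cov_mult_left gvec_e gvec_mult gvec_noise)

lemma cross_cov_noise:
  "gvec U \<Longrightarrow> cross_cov (noise t) U = cross_cov (eta t) U - T ** gain (P t) ** cross_cov (eps t) U"
  unfolding noise_def[abs_def]
  by (simp add: cross_cov_diff_left cross_cov_mult_left gvec_eta gvec_eps gvec_mult)

lemma eta_eps: "cross_cov (eta s) (eps t) = 0"
  by (subst cross_cov_transpose) (simp add: eps_eta transpose_def vec_eq_iff)

text \<open>Equality \<open>t = s\<close> is included, since \<open>e t\<close> contains noise only
  from times before \<open>t\<close>.\<close>

lemma cross_cov_e_future: "t \<le> s \<Longrightarrow> cross_cov (e t) (eta s) = 0 \<and> cross_cov (e t) (eps s) = 0"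
proof (induction t)
  case (Suc t)
  then show ?case
    by (simp add: cross_cov_e_Suc cross_cov_noise gvec_eta gvec_eps eta_eta eps_eta eta_eps eps_eps)
qed (simp add: e0_eta e0_eps)

lemma eta_e: "t \<le> s \<Longrightarrow> cross_cov (eta s) (e t) = 0"
  using cross_cov_e_future[of t s] cross_cov_transpose[of "eta s" "e t"]
  by (simp add: transpose_def vec_eq_iff)

lemma eps_e: "t \<le> s \<Longrightarrow> cross_cov (eps s) (e t) = 0"
  using cross_cov_e_future[of t s] cross_cov_transpose[of "eps s" "e t"]
  by (simp add: transpose_def vec_eq_iff)

lemma noise_e: "t \<le> s \<Longrightarrow> cross_cov (noise s) (e t) = 0"
  by (simp add: cross_cov_noise gvec_e eta_e eps_e)

lemma cross_cov_v_right:
  "gvec U \<Longrightarrow> cross_cov U (v t) = cross_cov U (e t) ** transpose Z + cross_cov U (eps t)"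
  using cross_cov_cong[of U U "v t" "\<lambda>\<omega>. Z *v e t \<omega> + eps t \<omega>"]
  by (simp add: v cross_cov_add_right cross_cov_mult_right gvec_e gvec_eps gvec_mult)

lemma cross_cov_v_left:
  "gvec U \<Longrightarrow> cross_cov (v t) U = Z ** cross_cov (e t) U + cross_cov (eps t) U"
  using cross_cov_cong[of "v t" "\<lambda>\<omega>. Z *v e t \<omega> + eps t \<omega>" U U]
  by (simp add: v cross_cov_add_left cross_cov_mult_left gvec_e gvec_eps gvec_mult)

text \<open>The filter may start from a biased value; the transition matrices wipe out the bias of
  \<open>e 0\<close>.\<close>

lemma mean_v_tendsto: "(\<lambda>t. mean_vec (v t)) \<longlonglongrightarrow> 0"
proof -
  have noise: "mean_vec (noise t) = 0" for t
    by (simp add: noise_def[abs_def] mean_vec_diff mean_vec_mult gvec_mult gvec_eta gvec_eps mean_eta mean_eps)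
  have "mean_vec (e (Suc t)) = closed_loop (P t) *v mean_vec (e t)" for t
    using mean_vec_cong[of "e (Suc t)" "\<lambda>\<omega>. closed_loop (P t) *v e t \<omega> + noise t \<omega>"]
    by (simp add: e_Suc noise_def[symmetric] mean_vec_add mean_vec_mult gvec_e gvec_mult gvec_noise noise)
  then have e: "mean_vec (e t) = trans_mat 0 t *v mean_vec (e 0)" for t
    by (induction t) (simp_all add: matrix_vector_mul_assoc)
  have "mean_vec (v t) = Z *v (trans_mat 0 t *v mean_vec (e 0))" for t
    using mean_vec_cong[of "v t" "\<lambda>\<omega>. Z *v e t \<omega> + eps t \<omega>"]
    by (simp add: v mean_vec_add mean_vec_mult gvec_e gvec_mult gvec_eps mean_eps flip: e)
  moreover have "(\<lambda>t. Z *v (trans_mat 0 t *v mean_vec (e 0))) \<longlonglongrightarrow> Z *v (0 *v mean_vec (e 0))"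
    by (intro tendsto_intros trans_mat_tendsto_0)
  ultimately show ?thesis by simp
qed

text \<open>As \<open>e t\<close> and \<open>noise t\<close> are uncorrelated, the error covariance
  satisfies a linear recursion, whose input converges because the gain does.\<close>

lemma cov_e_convergent: "\<exists>L. (\<lambda>t. cross_cov (e t) (e t)) \<longlonglongrightarrow> L"
proof -
  define V where "V t = V\<^sub>\<eta> + T ** gain (P t) ** V\<^sub>\<epsilon> ** transpose (T ** gain (P t))" for t
  have noise: "cross_cov (noise t) (noise t) = V t" for t
  proof -
    have right: "cross_cov U (noise t) = cross_cov U (eta t) - cross_cov U (eps t) ** transpose (T ** gain (P t))"
      if "gvec U" for U
      using that unfolding noise_def[abs_def]
      by (simp add: cross_cov_diff_right cross_cov_mult_right gvec_eta gvec_eps gvec_mult)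
    then show ?thesis
      by (simp add: cross_cov_noise right gvec_noise gvec_eta gvec_eps cov_eta cov_eps eps_eta eta_eps V_def
          bounded_bilinear.minus_left[OF bounded_bilinear_matrix_mult] matrix_mul_assoc)
  qed
  have zero: "cross_cov (e t) (noise t) = 0" for t
    using cross_cov_transpose[of "e t" "noise t"] by (simp add: noise_e transpose_def vec_eq_iff)
  have right: "cross_cov U (e (Suc t)) = cross_cov U (e t) ** transpose (closed_loop (P t)) + cross_cov U (noise t)"
    if "gvec U" for U t
    using that cross_cov_cong[of U U "e (Suc t)" "\<lambda>\<omega>. closed_loop (P t) *v e t \<omega> + noise t \<omega>"]
    by (simp add: e_Suc noise_def[symmetric] cross_cov_add_right cross_cov_mult_right gvec_e gvec_mult gvec_noise)
  have "cross_cov (e (Suc t)) (e (Suc t)) =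
    closed_loop (P t) ** cross_cov (e t) (e t) ** transpose (closed_loop (P t)) + V t" for t
    by (simp add: cross_cov_e_Suc gvec_e right gvec_noise zero noise noise_e matrix_mul_assoc)
  moreover obtain K where K: "(\<lambda>t. gain (P t)) \<longlonglongrightarrow> K" using gain_convergent by blast
  have "V \<longlonglongrightarrow> V\<^sub>\<eta> + T ** K ** V\<^sub>\<epsilon> ** transpose (T ** K)"
    unfolding V_def[abs_def] by (intro tendsto_intros K)
  ultimately show ?thesis by (rule covariance_convergent)
qed

lemma cov_v_convergent: "\<exists>L. (\<lambda>t. cross_cov (v t) (v t)) \<longlonglongrightarrow> L"
proof -
  obtain L where L: "(\<lambda>t. cross_cov (e t) (e t)) \<longlonglongrightarrow> L" using cov_e_convergent by blast
  have "cross_cov (v t) (v t) = Z ** cross_cov (e t) (e t) ** transpose Z + V\<^sub>\<epsilon>" for t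
    by (simp add: cross_cov_v_left cross_cov_v_right gvec_v gvec_e gvec_eps cross_cov_e_future eps_e cov_eps matrix_mul_assoc)
  moreover have "(\<lambda>t. Z ** cross_cov (e t) (e t) ** transpose Z + V\<^sub>\<epsilon>) \<longlonglongrightarrow> Z ** L ** transpose Z + V\<^sub>\<epsilon>"
    by (intro tendsto_intros L)
  ultimately show ?thesis by auto
qed

text \<open>The iteration starts at \<open>e (Suc s)\<close> and not at \<open>e s\<close>:
  \<open>noise s\<close> and \<open>v s\<close> share \<open>eps s\<close>, whereas later noise is
  uncorrelated with \<open>v s\<close>.\<close>

lemma cross_cov_e_v:
  "cross_cov (e (Suc s + k)) (v s) = trans_mat (Suc s) k ** cross_cov (e (Suc s)) (v s)"
proof (induction k)
  case (Suc k)
  have "cross_cov (noise (Suc s + k)) (v s) = 0"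
    by (simp add: cross_cov_v_right gvec_noise noise_e cross_cov_noise gvec_eps eta_eps eps_eps)
  then show ?case
    using Suc cross_cov_e_Suc[OF gvec_v, of "Suc s + k" s] by (simp add: matrix_mul_assoc)
qed simp

lemma cross_cov_v_bound:
  obtains C \<rho> where "0 \<le> \<rho>" "\<rho> < 1" "\<And>s k. norm (cross_cov (v (s + k)) (v s)) \<le> C * \<rho> ^ k"
proof -
  obtain C \<rho> where C: "0 < \<rho>" "\<rho> < 1" "0 < C" "\<And>s k. norm (trans_mat s k) \<le> C * \<rho> ^ k"
    using trans_mat_bound by metis
  obtain L where L: "(\<lambda>t. cross_cov (e t) (e t)) \<longlonglongrightarrow> L" using cov_e_convergent by blast
  obtain K where K: "(\<lambda>t. gain (P t)) \<longlonglongrightarrow> K" using gain_convergent by blast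
  obtain A where A: "(\<lambda>t. closed_loop (P t)) \<longlonglongrightarrow> A" using closed_loop_convergent by blast
  have "cross_cov (e (Suc s)) (v s) = closed_loop (P s) ** (cross_cov (e s) (e s) ** transpose Z) -
      T ** gain (P s) ** V\<^sub>\<epsilon>" for s
    unfolding cross_cov_e_Suc[OF gvec_v]
    by (simp add: cross_cov_v_right gvec_e gvec_noise cross_cov_e_future eta_e eps_e
        cross_cov_noise gvec_eps eta_eps cov_eps matrix_mul_assoc)
  then have "(\<lambda>s. cross_cov (e (Suc s)) (v s)) \<longlonglongrightarrow> A ** (L ** transpose Z) - T ** K ** V\<^sub>\<epsilon>"
    by (simp only:) (intro tendsto_intros A L K)
  then have "Bseq (\<lambda>s. cross_cov (e (Suc s)) (v s))" using convergentI convergent_imp_Bseq by blast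
  then obtain B where B: "B > 0" "\<And>s. norm (cross_cov (e (Suc s)) (v s)) \<le> B" unfolding Bseq_def by blast
  obtain V where "(\<lambda>t. cross_cov (v t) (v t)) \<longlonglongrightarrow> V" using cov_v_convergent by blast
  then have "Bseq (\<lambda>t. cross_cov (v t) (v t))" using convergentI convergent_imp_Bseq by blast
  then obtain D where D: "D > 0" "\<And>t. norm (cross_cov (v t) (v t)) \<le> D" unfolding Bseq_def by blast
  \<comment> \<open>\<open>D\<close> covers lag 0. A positive lag \<open>k\<close> has only
    \<open>k - 1\<close> transition factors, hence the division by \<rho>.\<close>
  define E where "E = max D (norm Z * (C * B) / \<rho>)"
  have "norm (cross_cov (v (s + k)) (v s)) \<le> E * \<rho> ^ k" for s k
  proof (cases k)
    case 0
    then show ?thesis using D(2)[of s] by (simp add: E_def)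
  next
    case (Suc l)
    have "cross_cov (eps (s + k)) (v s) = 0"
      by (simp add: Suc cross_cov_v_right gvec_eps eps_e eps_eps)
    then have "cross_cov (v (s + k)) (v s) = Z ** (trans_mat (Suc s) l ** cross_cov (e (Suc s)) (v s))"
      using cross_cov_e_v[of s l] by (simp add: cross_cov_v_left gvec_v Suc)
    then have "norm (cross_cov (v (s + k)) (v s)) \<le>
        norm Z * (norm (trans_mat (Suc s) l) * norm (cross_cov (e (Suc s)) (v s)))"
      by (simp add: order_trans[OF norm_matrix_mult_le mult_left_mono[OF norm_matrix_mult_le]])
    also have "\<dots> \<le> norm Z * ((C * \<rho> ^ l) * B)"
      using C by (intro mult_left_mono mult_mono C(4) B(2)) auto
    also have "\<dots> = (norm Z * (C * B) / \<rho>) * \<rho> ^ k" using C(1) by (simp add: Suc)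
    also have "\<dots> \<le> E * \<rho> ^ k" using C by (intro mult_right_mono) (auto simp: E_def)
    finally show ?thesis .
  qed
  then show thesis using that C by (metis less_imp_le)
qed

end

subsection \<open>Rank conditions\<close>

lemma transpose_mat_pow: "transpose (mat_pow T k) = mat_pow (transpose T) k"
proof (induction k)
  case (Suc k)
  then show ?case unfolding mat_pow_Suc_right[of "transpose T"] by (simp add: matrix_transpose_mul)
qed simp

lemma bij_betw_pos_of: "bij_betw (pos_of :: 'p::{finite,linorder} \<Rightarrow> nat) UNIV {..<CARD('p)}"
proof -
  have mono: "pos_of i < pos_of j" if "i < j" for i j :: 'p
    unfolding pos_of_def using that by (intro psubset_card_mono) auto
  then have inj: "inj (pos_of :: 'p \<Rightarrow> nat)"
    by (metis injI less_irrefl linorder_less_linear)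
  have "pos_of k < CARD('p)" for k :: 'p
    unfolding pos_of_def by (intro psubset_card_mono) auto
  then have "range (pos_of :: 'p \<Rightarrow> nat) \<subseteq> {..<CARD('p)}" by auto
  then have "range (pos_of :: 'p \<Rightarrow> nat) = {..<CARD('p)}"
    using inj by (intro card_subset_eq) (auto simp: card_image)
  with inj show ?thesis by (simp add: bij_betw_def)
qed

text \<open>Full column rank makes the transposed observability matrix surjective; a preimage of
  \<open>x\<close>, cut into blocks, yields the controls.\<close>

lemma observability_spans:
  fixes Z :: "('d::finite, 'p::{finite,linorder}) rmat" and T :: "('p, 'p) rmat" and x :: "'p rvec"
  assumes "rank (observability_matrix Z T) = CARD('p)"
  shows "\<exists>w. x = (\<Sum>k<CARD('p). mat_pow (transpose T) k *v (transpose Z *v w k))"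
proof -
  let ?O = "observability_matrix Z T"
  have "surj ((*v) (transpose ?O))"
    using assms by (simp add: full_rank_surjective[symmetric] rank_transpose)
  then obtain y where y: "x = transpose ?O *v y" by (metis surjD)
  have inv: "inv_into UNIV pos_of (pos_of k) = k" for k :: 'p
    by (rule bij_betw_inv_into_left[OF bij_betw_pos_of]) simp
  \<comment> \<open>\<open>w k\<close> is the block of \<open>y\<close> at the index whose position
    is \<open>k\<close>.\<close>
  define w where "w k = (\<chi> i. y $ (inv_into UNIV pos_of k, i))" for k
  have "x $ j = (\<Sum>k\<in>(UNIV :: 'p set). mat_pow (transpose T) (pos_of k) *v (transpose Z *v w (pos_of k))) $ j" for j
  proof -
    have "x $ j = (\<Sum>r\<in>UNIV. ?O $ r $ j * y $ r)"
      by (simp add: y matrix_vector_mult_def transpose_def)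
    also have "\<dots> = (\<Sum>k\<in>(UNIV :: 'p set). \<Sum>i\<in>UNIV. ?O $ (k, i) $ j * y $ (k, i))"
      by (simp add: sum.cartesian_product UNIV_Times_UNIV[symmetric] del: UNIV_Times_UNIV)
    also have "\<dots> = (\<Sum>k\<in>(UNIV :: 'p set). (transpose (Z ** mat_pow T (pos_of k)) *v w (pos_of k)) $ j)"
      by (simp add: observability_matrix_def matrix_vector_mult_def transpose_def w_def inv)
    finally show ?thesis
      by (simp add: matrix_transpose_mul transpose_mat_pow matrix_vector_mul_assoc)
  qed
  then have "x = (\<Sum>k\<in>(UNIV :: 'p set). mat_pow (transpose T) (pos_of k) *v (transpose Z *v w (pos_of k)))"
    by (simp add: vec_eq_iff)
  also have "\<dots> = (\<Sum>k<CARD('p). mat_pow (transpose T) k *v (transpose Z *v w k))"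
    by (rule sum.reindex_bij_betw[OF bij_betw_pos_of])
  finally show ?thesis by (rule exI[of _ w])
qed

text \<open>Full row rank makes the transpose injective, and the hypothesis says that all blocks of
  its value at \<open>x\<close> vanish.\<close>

lemma controllability_separates:
  fixes T :: "('p::{finite,linorder}, 'p) rmat" and R :: "('p, 'r::finite) rmat" and x :: "'p rvec"
  assumes "rank (controllability_matrix T R) = CARD('p)"
    and zero: "\<And>k. k < CARD('p) \<Longrightarrow> transpose R *v (mat_pow (transpose T) k *v x) = 0"
  shows "x = 0"
proof -
  let ?C = "controllability_matrix T R"
  have inj: "inj ((*v) (transpose ?C))"
    using assms(1) by (simp add: full_rank_injective[symmetric] rank_transpose)
  have "(transpose ?C *v x) $ c = 0" for c
  proof -
    have "(transpose ?C *v x) $ c = (transpose (mat_pow T (pos_of (fst c)) ** R) *v x) $ snd c"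
      by (simp add: controllability_matrix_def matrix_vector_mult_def transpose_def)
    also have "\<dots> = (transpose R *v (mat_pow (transpose T) (pos_of (fst c)) *v x)) $ snd c"
      by (simp add: matrix_transpose_mul transpose_mat_pow matrix_vector_mul_assoc)
    also have "\<dots> = 0"
      using zero[of "pos_of (fst c)"] bij_betwE[OF bij_betw_pos_of[where 'p = 'p]] by simp
    finally show ?thesis .
  qed
  then have "transpose ?C *v x = transpose ?C *v 0" by (simp add: vec_eq_iff)
  with inj show ?thesis by (rule injD)
qed

lemma quad_congruence:
  fixes R :: "real^'r^'p"
  shows "x \<bullet> ((R ** Q ** transpose R) *v x) = (transpose R *v x) \<bullet> (Q *v (transpose R *v x))"
  using inner_matrix_vector_transpose[of x R "Q *v (transpose R *v x)"]
  by (simp add: matrix_vector_mul_assoc matrix_mul_assoc)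

section \<open>From the laws in the model to means and covariances\<close>

lemma (in gaussian_family) gvecI_coord_rvs: "coord_rvs X \<subseteq> S \<Longrightarrow> gvec X"
  unfolding gvec_def coord_rvs_def using gspan_base by blast

text \<open>The law gives the variance of every linear functional, so the covariance matrix and
  \<Sigma> have the same quadratic form; both are symmetric.\<close>

lemma (in gaussian_family) normal_vec_moments:
  assumes X: "gvec X" and normal: "normal_vec X \<mu> \<Sigma>"
  shows "mean_vec X = \<mu>" "cross_cov X X = \<Sigma>"
proof -
  have rv: "normal_rv (\<lambda>\<omega>. u \<bullet> X \<omega>) (u \<bullet> \<mu>) (u \<bullet> (\<Sigma> *v u))" for u
    using normal by (simp add: normal_vec_def)
  show "mean_vec X = \<mu>"
    using normal_rv_moments(3)[OF rv[of "axis i 1" for i]] by (simp add: mean_vec_def vec_eq_iff inner_axis')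
  have "u \<bullet> (cross_cov X X *v u) = u \<bullet> (\<Sigma> *v u)" for u
  proof -
    have U: "(\<lambda>\<omega>. u \<bullet> X \<omega>) = (\<lambda>\<omega>. \<Sum>i\<in>UNIV. u $ i * X \<omega> $ i)" by (simp add: inner_vec_def)
    have G: "(\<lambda>\<omega>. u \<bullet> X \<omega>) \<in> gspan"
      unfolding U by (intro gspan_sum gspan_scale gvec_nth X)
    have *: "covar (\<lambda>\<omega>. u \<bullet> X \<omega>) Y = (\<Sum>i\<in>UNIV. u $ i * covar (\<lambda>\<omega>. X \<omega> $ i) Y)" if "Y \<in> gspan" for Y
      unfolding U using that by (subst covar_sum_left) (simp_all add: covar_scale_left gspan_scale gvec_nth X)
    have "u \<bullet> (\<Sigma> *v u) = covar (\<lambda>\<omega>. u \<bullet> X \<omega>) (\<lambda>\<omega>. u \<bullet> X \<omega>)"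
      using normal_rv_moments(3,4)[OF rv[of u]] by (simp add: covar_def power2_eq_square)
    also have "\<dots> = (\<Sum>i\<in>UNIV. u $ i * covar (\<lambda>\<omega>. u \<bullet> X \<omega>) (\<lambda>\<omega>. X \<omega> $ i))"
      by (simp add: *[OF G] covar_commute)
    also have "\<dots> = (\<Sum>i\<in>UNIV. u $ i * (\<Sum>j\<in>UNIV. u $ j * cross_cov X X $ i $ j))"
      by (simp add: *[OF gvec_nth[OF X]] cross_cov_nth covar_commute)
    also have "\<dots> = u \<bullet> (cross_cov X X *v u)"
      by (simp add: inner_vec_def matrix_vector_mult_def mult.commute)
    finally show ?thesis by simp
  qed
  then show "cross_cov X X = \<Sigma>"
    using normal
    by (intro matrix_eq_of_quad_eq[OF cross_cov_transpose[symmetric]]) (simp_all add: normal_vec_def)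
qed

theorem mainTheorem2:
  fixes M :: "'w measure"
    and blk :: "'p::{finite,linorder} \<Rightarrow> 'd::{finite,linorder}"
    and Z :: "('d, 'p) rmat" and T :: "('p, 'p) rmat"
    and \<Sigma>\<epsilon> \<Sigma>\<epsilon>' :: "('d, 'd) rmat" and \<Sigma>\<eta> \<Sigma>\<eta>' P\<^sub>1 P\<^sub>1' :: "('p, 'p) rmat"
    and a\<^sub>1 a\<^sub>1' :: "'p rvec"
    and y eps :: "nat \<Rightarrow> 'w \<Rightarrow> 'd rvec" and \<alpha> eta :: "nat \<Rightarrow> 'w \<Rightarrow> 'p rvec"
    and v' :: "nat \<Rightarrow> 'w \<Rightarrow> 'd rvec" and a' :: "nat \<Rightarrow> 'w \<Rightarrow> 'p rvec"
    and F' :: "nat \<Rightarrow> ('d, 'd) rmat" and K' :: "nat \<Rightarrow> ('p, 'd) rmat"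
    and L' P' :: "nat \<Rightarrow> ('p, 'p) rmat"
    and R :: "('p, 'r::finite) rmat" and Q :: "('r, 'r) rmat"
    and R' :: "('p, 's::finite) rmat" and Q' :: "('s, 's) rmat"
    and n\<^sub>0 :: nat
  assumes prob: "prob_space M"
    and blk: "mono blk" "surj blk"
    and Z_block: "row_block_diagonal blk Z"
    and T_block: "block_diagonal blk T"
    (* true model *)
    and observation: "\<And>t \<omega>. t \<ge> 1 \<Longrightarrow> \<omega> \<in> space M \<Longrightarrow> y t \<omega> = Z *v \<alpha> t \<omega> + eps t \<omega>"
    and state: "\<And>t \<omega>. t \<ge> 1 \<Longrightarrow> \<omega> \<in> space M \<Longrightarrow> \<alpha> (t + 1) \<omega> = T *v \<alpha> t \<omega> + eta t \<omega>"
    and eps_normal: "\<And>t. t \<ge> 1 \<Longrightarrow> prob_space.normal_vec M (eps t) 0 \<Sigma>\<epsilon>"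
    and eta_normal: "\<And>t. t \<ge> 1 \<Longrightarrow> prob_space.normal_vec M (eta t) 0 \<Sigma>\<eta>"
    and init_normal: "prob_space.normal_vec M (\<alpha> 1) a\<^sub>1 P\<^sub>1"
    and joint: "prob_space.jointly_gaussian M
        (coord_rvs (\<alpha> 1) \<union> (\<Union>t\<in>{1..}. coord_rvs (eps t)) \<union> (\<Union>t\<in>{1..}. coord_rvs (eta t)))"
    and uncorr_init_eps: "\<And>t. t \<ge> 1 \<Longrightarrow> prob_space.uncorrelated M (\<alpha> 1) (eps t)"
    and uncorr_init_eta: "\<And>t. t \<ge> 1 \<Longrightarrow> prob_space.uncorrelated M (\<alpha> 1) (eta t)"
    and uncorr_eps: "\<And>s t. s \<ge> 1 \<Longrightarrow> t \<ge> 1 \<Longrightarrow> s \<noteq> t \<Longrightarrow> prob_space.uncorrelated M (eps s) (eps t)"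
    and uncorr_eta: "\<And>s t. s \<ge> 1 \<Longrightarrow> t \<ge> 1 \<Longrightarrow> s \<noteq> t \<Longrightarrow> prob_space.uncorrelated M (eta s) (eta t)"
    and uncorr_eps_eta: "\<And>s t. s \<ge> 1 \<Longrightarrow> t \<ge> 1 \<Longrightarrow> prob_space.uncorrelated M (eps s) (eta t)"
    (* filter disregarding correlation *)
    and \<Sigma>\<epsilon>': "\<Sigma>\<epsilon>' = diag_part \<Sigma>\<epsilon>"
    and \<Sigma>\<eta>': "\<Sigma>\<eta>' = block_diag_part blk \<Sigma>\<eta>"
    and P\<^sub>1'_psd: "pos_semidef P\<^sub>1'"
    and P\<^sub>1'_block: "block_diagonal blk P\<^sub>1'"
    and a'_1: "\<And>\<omega>. \<omega> \<in> space M \<Longrightarrow> a' 1 \<omega> = a\<^sub>1'"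
    and P'_1: "P' 1 = P\<^sub>1'"
    and v': "\<And>t \<omega>. t \<ge> 1 \<Longrightarrow> \<omega> \<in> space M \<Longrightarrow> v' t \<omega> = y t \<omega> - Z *v a' t \<omega>"
    and F': "\<And>t. t \<ge> 1 \<Longrightarrow> F' t = Z ** P' t ** transpose Z + \<Sigma>\<epsilon>'"
    and K': "\<And>t. t \<ge> 1 \<Longrightarrow> K' t = P' t ** transpose Z ** matrix_inv (F' t)"
    and L': "\<And>t. t \<ge> 1 \<Longrightarrow> L' t = mat 1 - K' t ** Z"
    and a'_Suc: "\<And>t \<omega>. t \<ge> 1 \<Longrightarrow> \<omega> \<in> space M \<Longrightarrow>
        a' (t + 1) \<omega> = T *v a' t \<omega> + (T ** K' t) *v v' t \<omega>"
    and P'_Suc: "\<And>t. t \<ge> 1 \<Longrightarrow>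
        P' (t + 1) = T ** P' t ** transpose (L' t) ** transpose T + \<Sigma>\<eta>'"
    and A1: "pos_def \<Sigma>\<epsilon>" "pos_def \<Sigma>\<epsilon>'"
    and A2: "rank (observability_matrix Z T) = CARD('p)"
    and A3: "\<Sigma>\<eta> = R ** Q ** transpose R" "pos_def Q"
        "rank (controllability_matrix T R) = CARD('p)"
    and A3': "\<Sigma>\<eta>' = R' ** Q' ** transpose R'" "pos_def Q'"
        "rank (controllability_matrix T R') = CARD('p)"
    and A4: "\<exists>B>0. \<forall>t\<ge>1. \<forall>k l. k \<le> l \<and> l \<le> t - 1 \<longrightarrow>
        frobenius_norm (ordered_prod (\<lambda>i. T ** L' (t - i)) k l) \<le> B"
    and n\<^sub>0: "n\<^sub>0 \<ge> 1"
  shows "\<exists>V. (\<lambda>t. prob_space.cov_matrix M (v' t)) \<longlonglongrightarrow> V \<and>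
    (\<forall>i j. prob_space.converges_in_prob M
      (\<lambda>n \<omega>. ((1 / (real n - real n\<^sub>0 + 1)) *\<^sub>R (\<Sum>t=n\<^sub>0..n. outer_prod (v' t \<omega>) (v' t \<omega>))) $ i $ j)
      (V $ i $ j))"
proof -
  interpret prob_space M by (rule prob)
  define Sp where "Sp = coord_rvs (\<alpha> 1) \<union> (\<Union>t\<in>{1..}. coord_rvs (eps t)) \<union> (\<Union>t\<in>{1..}. coord_rvs (eta t))"
  interpret gaussian_family M Sp
    by unfold_locales (use joint in \<open>simp add: Sp_def\<close>)
  have gvec_\<alpha>1: "gvec (\<alpha> 1)"
    by (rule gvecI_coord_rvs) (auto simp: Sp_def)
  have gvec_eps: "gvec (eps (Suc t))" and gvec_eta: "gvec (eta (Suc t))" for t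
    by (rule gvecI_coord_rvs; force simp: Sp_def)+
  have \<Sigma>\<eta>'_psd: "pos_semidef \<Sigma>\<eta>'"
  proof -
    have "transpose \<Sigma>\<eta>' = \<Sigma>\<eta>'"
      unfolding A3'(1) using A3'(2) by (simp add: matrix_transpose_mul matrix_mul_assoc pos_def_def)
    moreover have "0 \<le> x \<bullet> (\<Sigma>\<eta>' *v x)" for x
      unfolding A3'(1) quad_congruence by (rule pos_semidef_quad_nonneg[OF pos_def_imp_pos_semidef[OF A3'(2)]])
    ultimately show ?thesis by (simp add: pos_semidef_def)
  qed
  interpret riccati Z T \<Sigma>\<epsilon>' \<Sigma>\<eta>'
    by unfold_locales (rule A1(2), rule \<Sigma>\<eta>'_psd)
  \<comment> \<open>The model counts time from 1, the locales from 0.\<close>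
  define P where "P t = P' (Suc t)" for t
  have K'_gain: "K' (Suc t) = gain (P t)" for t
    by (simp add: K' F' gain_def innov_cov_def P_def)
  have L'_filt: "L' (Suc t) = filt (P t)" for t
    by (simp add: L' filt_def K'_gain)
  have P_Suc: "P (Suc t) = ric (P t)" for t
    using P'_Suc[of "Suc t"] by (simp add: ric_def L'_filt P_def)
  define e where "e t \<omega> = \<alpha> (Suc t) \<omega> - a' (Suc t) \<omega>" for t \<omega>
  have v_eq: "v' (Suc t) \<omega> = Z *v e t \<omega> + eps (Suc t) \<omega>" if "\<omega> \<in> space M" for t \<omega>
    using that by (simp add: v' observation e_def matrix_vector_mult_diff_distrib)
  have e0: "e 0 \<omega> = \<alpha> 1 \<omega> - a\<^sub>1'" if "\<omega> \<in> space M" for \<omega>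
    using a'_1[OF that] by (simp add: e_def)
  \<comment> \<open>The initial error differs from the initial state by a constant, which does not
    affect covariances.\<close>
  have e0_cov: "cross_cov (e 0) U = cross_cov (\<alpha> 1) U" if "gvec U" for U :: "'w \<Rightarrow> real^'n"
    using cross_cov_cong[of "e 0" "\<lambda>\<omega>. \<alpha> 1 \<omega> - a\<^sub>1'" U U] that
    by (simp add: e0 cross_cov_diff_left gvec_\<alpha>1[simplified] gvec_const cross_cov_const_left)
  interpret prediction_error Z T \<Sigma>\<epsilon>' \<Sigma>\<eta>' P "CARD('p)" M Sp e "\<lambda>t. eta (Suc t)" "\<lambda>t. eps (Suc t)"
    "\<lambda>t. v' (Suc t)" \<Sigma>\<epsilon> \<Sigma>\<eta>
  proof unfold_locales
    show "pos_semidef (P 0)" using P\<^sub>1'_psd P'_1 by (simp add: P_def)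
    show "P (Suc t) = ric (P t)" for t by (rule P_Suc)
    show "CARD('p) > 0" by simp
    show "\<exists>w. x = (\<Sum>k<CARD('p). mat_pow (transpose T) k *v (transpose Z *v w k))" for x
      by (rule observability_spans[OF A2])
    show "x = 0" if zero: "\<And>k. k < CARD('p) \<Longrightarrow>
      (mat_pow (transpose T) k *v x) \<bullet> (\<Sigma>\<eta>' *v (mat_pow (transpose T) k *v x)) = 0" for x
    proof (rule controllability_separates[OF A3'(3)])
      fix k assume "k < CARD('p)"
      \<comment> \<open>The form of \<open>\<Sigma>\<eta>'\<close> is that of \<open>Q'\<close> at
        the image under \<open>transpose R'\<close>, and \<open>Q'\<close> is definite.\<close>
      from zero[OF this] show "transpose R' *v (mat_pow (transpose T) k *v x) = 0"
        using A3'(2) unfolding A3'(1) quad_congruence pos_def_def by force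
    qed
    show "gvec (e 0)"
      by (rule gvec_cong[OF gvec_diff[OF gvec_\<alpha>1 gvec_const[of a\<^sub>1']]]) (rule e0)
    show "gvec (eta (Suc t))" "gvec (eps (Suc t))" for t by (rule gvec_eta gvec_eps)+
    show "mean_vec (eta (Suc t)) = 0" "cross_cov (eta (Suc t)) (eta (Suc t)) = \<Sigma>\<eta>" for t
      by (rule normal_vec_moments[OF gvec_eta eta_normal]; simp)+
    show "mean_vec (eps (Suc t)) = 0" "cross_cov (eps (Suc t)) (eps (Suc t)) = \<Sigma>\<epsilon>" for t
      by (rule normal_vec_moments[OF gvec_eps eps_normal]; simp)+
    show "cross_cov (e 0) (eta (Suc t)) = 0" "cross_cov (e 0) (eps (Suc t)) = 0" for t
      using uncorr_init_eta[of "Suc t"] uncorr_init_eps[of "Suc t"]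
      by (simp_all add: e0_cov gvec_eta gvec_eps uncorrelated_def)
    show "s \<noteq> t \<Longrightarrow> cross_cov (eta (Suc s)) (eta (Suc t)) = 0"
      "s \<noteq> t \<Longrightarrow> cross_cov (eps (Suc s)) (eps (Suc t)) = 0"
      "cross_cov (eps (Suc s)) (eta (Suc t)) = 0" for s t
      using uncorr_eta[of "Suc s" "Suc t"] uncorr_eps[of "Suc s" "Suc t"] uncorr_eps_eta[of "Suc s" "Suc t"]
      by (simp_all add: uncorrelated_def)
    show "v' (Suc t) \<omega> = Z *v e t \<omega> + eps (Suc t) \<omega>" if "\<omega> \<in> space M" for t \<omega>
      using that by (rule v_eq)
    show "e (Suc t) \<omega> = closed_loop (P t) *v e t \<omega> +
        (eta (Suc t) \<omega> - (T ** gain (P t)) *v eps (Suc t) \<omega>)" if "\<omega> \<in> space M" for t \<omega>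
    proof -
      have "e (Suc t) \<omega> = T *v e t \<omega> + eta (Suc t) \<omega> - (T ** gain (P t)) *v v' (Suc t) \<omega>"
        using state[of "Suc t" \<omega>] a'_Suc[of "Suc t" \<omega>] that
        by (simp add: e_def K'_gain matrix_vector_mult_diff_distrib)
      then show ?thesis
        by (simp add: v_eq[OF that] closed_loop_def filt_def matrix_mult_diff_right matrix_vector_right_distrib
            matrix_vector_mult_diff_rdistrib matrix_vector_mul_assoc matrix_mul_assoc)
    qed
  qed
  obtain V where V: "(\<lambda>t. cross_cov (v' (Suc t)) (v' (Suc t))) \<longlonglongrightarrow> V"
    using cov_v_convergent by blast
  then have lim: "(\<lambda>t. cov_matrix (v' t)) \<longlonglongrightarrow> V"
    unfolding cov_matrix_def by (rule LIMSEQ_imp_Suc)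
  obtain C \<rho> where C: "0 \<le> \<rho>" "\<rho> < 1"
    "\<And>s k. norm (cross_cov (v' (Suc (s + k))) (v' (Suc s))) \<le> C * \<rho> ^ k"
    using cross_cov_v_bound by metis
  obtain n1 where n1: "n\<^sub>0 = Suc n1" using n\<^sub>0 by (cases n\<^sub>0) auto
  \<comment> \<open>The average from \<open>n\<^sub>0\<close> on is an average from 0 on of the
    shifted sequence; the covariance bound is uniform in \<open>s\<close>, so it survives the
    shift.\<close>
  define w where "w k = v' (Suc (k + n1))" for k
  have w: "gvec (w k)" for k unfolding w_def by (rule gvec_v)
  have w_mean: "(\<lambda>k. mean_vec (w k)) \<longlonglongrightarrow> 0"
    unfolding w_def by (rule LIMSEQ_ignore_initial_segment[OF mean_v_tendsto])
  have w_var: "(\<lambda>k. cross_cov (w k) (w k)) \<longlonglongrightarrow> V"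
    unfolding w_def by (rule LIMSEQ_ignore_initial_segment[OF V])
  have w_cov: "norm (cross_cov (w (s + k)) (w s)) \<le> C * \<rho> ^ k" for s k
    using C(3)[of "s + n1" k] by (simp add: w_def ac_simps)
  note avg = product_average_converges[OF w w_mean w_var w_cov C(1,2)]
  have "converges_in_prob (\<lambda>n \<omega>. ((1 / (real n - real n\<^sub>0 + 1)) *\<^sub>R
      (\<Sum>t=n\<^sub>0..n. outer_prod (v' t \<omega>) (v' t \<omega>))) $ i $ j) (V $ i $ j)" for i j
  proof -
    \<comment> \<open>For \<open>n < n\<^sub>0\<close> both sums are empty and both sides are 0,
      whatever the factor in front.\<close>
    have eq: "((1 / (real n - real n\<^sub>0 + 1)) *\<^sub>R (\<Sum>t=n\<^sub>0..n. outer_prod (v' t \<omega>) (v' t \<omega>))) $ i $ j =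
        (\<Sum>k<Suc n - n\<^sub>0. w k \<omega> $ i * w k \<omega> $ j) / real (Suc n - n\<^sub>0)" for n \<omega>
    proof -
      have "(\<Sum>t=n\<^sub>0..n. v' t \<omega> $ i * v' t \<omega> $ j) = (\<Sum>k<Suc n - n\<^sub>0. w k \<omega> $ i * w k \<omega> $ j)"
        by (rule sum.reindex_bij_witness[where j = "\<lambda>t. t - n\<^sub>0" and i = "\<lambda>k. k + n\<^sub>0"])
          (auto simp: w_def n1)
      moreover have "real (Suc n - n\<^sub>0) = real n - real n\<^sub>0 + 1" if "n\<^sub>0 \<le> n" using that by simp
      ultimately show ?thesis
        by (cases "n\<^sub>0 \<le> n") (simp_all add: outer_prod_def sum_component)
    qed
    show ?thesis
      unfolding eq
    proof (rule converges_in_probI)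
      show "integrable M (\<lambda>\<omega>. (\<Sum>k<Suc n - n\<^sub>0. w k \<omega> $ i * w k \<omega> $ j) / real (Suc n - n\<^sub>0))" for n
        by (intro integrable_divide Bochner_Integration.integrable_sum avg(1))
      show "(\<lambda>n. expectation (\<lambda>\<omega>. \<bar>(\<Sum>k<Suc n - n\<^sub>0. w k \<omega> $ i * w k \<omega> $ j) / real (Suc n - n\<^sub>0) - V $ i $ j\<bar>))
        \<longlonglongrightarrow> 0"
      \<comment> \<open>After the shift by \<open>n1\<close> the number of summands is exactly
        \<open>n\<close>.\<close>
      proof (rule LIMSEQ_offset[where k = n1])
        show "(\<lambda>n. expectation (\<lambda>\<omega>. \<bar>(\<Sum>k<Suc (n + n1) - n\<^sub>0. w k \<omega> $ i * w k \<omega> $ j) /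
            real (Suc (n + n1) - n\<^sub>0) - V $ i $ j\<bar>)) \<longlonglongrightarrow> 0"
          using avg(2)[of i j] by (simp add: n1)
      qed
    qed
  qed
  with lim show ?thesis by blast
qed

end
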